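(* There is no algorithm in the radical computation tree model, and no algorithm in the root computation tree model, that for every bipyramid with integer edge lengths (given by its combinatorial structure and edge lengths) computes the coordinates of its geometric realization as a convex polyhedron.
   Context: A bipyramid is a convex polyhedron whose faces are isosceles triangles, with their bases forming a cycle (the equator) and their apexes meeting at two vertices (the poles); here all edges incident to the poles have a common length and all edge lengths are integers. The models are those of Bannister, Devanny, Eppstein and Goodrich: algebraic computation trees whose nodes perform arithmetic operations ($+,-,\times,\div$) on the inputs and previously computed values and branch on comparisons; in the radical computation tree model nodes may additionally compute $k$-th roots of previously computed real values for arbitrary positive integers $k$; in the root computation tree model nodes may additionally compute roots of polynomials of bounded degree (a fixed bound $d$) whose coefficients are previously computed values. *)

theory Defs
  imports "HOL-Analysis.Analysis" "HOL-Computational_Algebra.Polynomial"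
begin

text \<open>A computation node appends one new value to the store of values
(initially the list of inputs).  Store positions are referred to by index;
out-of-range indices read as 0.\<close>

datatype node_op =
    Const rat
  | Add nat nat | Sub nat nat | Mul nat nat | Div nat nat
  | KRoot nat nat
  | PolyRoot "nat list" nat

datatype ctree =
    Leaf "nat list"
  | Step node_op ctree
  | Branch nat nat ctree ctree

definition get :: "real list \<Rightarrow> nat \<Rightarrow> real" where
  "get vs i = (if i < length vs then vs ! i else 0)"

definition real_roots_sorted :: "real poly \<Rightarrow> real list" where
  "real_roots_sorted p = (if p = 0 then [] else sorted_list_of_set {x. poly p x = 0})"

fun eval_op :: "node_op \<Rightarrow> real list \<Rightarrow> real" where
  "eval_op (Const c) vs = real_of_rat c"
| "eval_op (Add i j) vs = get vs i + get vs j"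
| "eval_op (Sub i j) vs = get vs i - get vs j"
| "eval_op (Mul i j) vs = get vs i * get vs j"
| "eval_op (Div i j) vs = get vs i / get vs j"
| "eval_op (KRoot k i) vs = root k (get vs i)"
| "eval_op (PolyRoot cs j) vs =
     (let rs = real_roots_sorted (Poly (map (get vs) cs)) in
      if j < length rs then rs ! j else 0)"

fun run :: "ctree \<Rightarrow> real list \<Rightarrow> real list" where
  "run (Leaf outs) vs = map (get vs) outs"
| "run (Step f t) vs = run t (vs @ [eval_op f vs])"
| "run (Branch i j t1 t2) vs = (if get vs i < get vs j then run t1 vs else run t2 vs)"

fun ops_of :: "ctree \<Rightarrow> node_op set" where
  "ops_of (Leaf outs) = {}"
| "ops_of (Step f t) = insert f (ops_of t)"
| "ops_of (Branch i j t1 t2) = ops_of t1 \<union> ops_of t2"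

definition radical_tree :: "ctree \<Rightarrow> bool" where
  "radical_tree t \<longleftrightarrow> (\<forall>f\<in>ops_of t. \<forall>cs j. f \<noteq> PolyRoot cs j)"

definition root_tree :: "nat \<Rightarrow> ctree \<Rightarrow> bool" where
  "root_tree d t \<longleftrightarrow> (\<forall>f\<in>ops_of t. (\<forall>k i. f \<noteq> KRoot k i) \<and>
                          (\<forall>cs j. f = PolyRoot cs j \<longrightarrow> length cs \<le> d + 1))"

text \<open>Equator vertices p 0, ..., p (n-1) in cyclic order, poles N and S.
The convex hull of the n+2 points must be a convex polyhedron whose facets are
exactly the triangles N p_i p_(i+1) and S p_i p_(i+1); equator edge p_i p_(i+1)
has length l i and every edge at a pole has length s.\<close>
definition bipyramid_realization ::
  "nat \<Rightarrow> real \<Rightarrow> (nat \<Rightarrow> real) \<Rightarrow> real^3 \<Rightarrow> real^3 \<Rightarrow> (nat \<Rightarrow> real^3) \<Rightarrow> bool" where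
  "bipyramid_realization n s l N S p \<longleftrightarrow>
     (let P = convex hull (insert N (insert S (p ` {..<n}))) in
      3 \<le> n \<and> N \<noteq> S \<and> N \<notin> p ` {..<n} \<and> S \<notin> p ` {..<n} \<and> inj_on p {..<n} \<and>
      aff_dim P = 3 \<and>
      {F. F facet_of P} =
        (\<lambda>i. convex hull {N, p i, p (Suc i mod n)}) ` {..<n} \<union>
        (\<lambda>i. convex hull {S, p i, p (Suc i mod n)}) ` {..<n} \<and>
      (\<forall>i<n. dist (p i) (p (Suc i mod n)) = l i \<and> dist N (p i) = s \<and> dist S (p i) = s))"

definition int_bipyramid :: "nat \<Rightarrow> int \<Rightarrow> (nat \<Rightarrow> int) \<Rightarrow> bool" where
  "int_bipyramid n s l \<longleftrightarrow>
     (\<exists>N S p. bipyramid_realization n (of_int s) (\<lambda>i. of_int (l i)) N S p)"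

definition out_point :: "real list \<Rightarrow> nat \<Rightarrow> real^3" where
  "out_point out k = vector [out ! (3*k), out ! (3*k+1), out ! (3*k+2)]"

text \<open>An algorithm is a family of trees, one for each combinatorial type
(n = number of equator vertices). Input: [s, l 0, ..., l (n-1)].
Output: equator points 0..n-1, then the poles as points n and n+1.\<close>
definition computes_bipyramids :: "(nat \<Rightarrow> ctree) \<Rightarrow> bool" where
  "computes_bipyramids T \<longleftrightarrow>
     (\<forall>n s l. int_bipyramid n s l \<longrightarrow>
        (let out = run (T n) (map real_of_int (s # map l [0..<n])) in
         length out = 3 * (n + 2) \<and>
         bipyramid_realization n (of_int s) (\<lambda>i. of_int (l i))
            (out_point out n) (out_point out (n+1)) (out_point out)))"

end

theory Submission
  imports Defs "HOL-Algebra.Finite_Extensions" "HOL-Computational_Algebra.Polynomial_Factorial"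
    "HOL-Computational_Algebra.Fundamental_Theorem_Algebra"
begin

text \<open>Both parts use equators that are regular \<open>n\<close>-gons with unit sides. From the coordinates of any
  realization one obtains by rational operations the cosine of the rotation angle of the
  equator, and this angle belongs to a primitive \<open>n\<close>-th root of unity \<open>\<zeta>\<close>. On a fixed integral
  input all values of a computation lie in a tower of real fields over the rationals.

  In the root model take \<open>n = q\<^sup>2\<close> for an odd prime \<open>q > d\<close>: the steps of the tower have degrees at
  most \<open>d\<close>, and adjoining \<open>\<zeta>\<close> contributes at most a factor 2, whereas \<open>\<zeta>\<close> has degree \<open>q (q - 1)\<close>.

  In the radical model take \<open>n = 9\<close>: twice the cosine is a root of \<open>x\<^sup>3 - 3 x + 1\<close>, a cubic with three real
  roots, and such a root cannot enter through real radicals (casus irreducibilis).\<close>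

text \<open>An algorithm may place the solid anywhere in space, so the argument starts from an
  isometry invariant: the cosine of the angle under which two neighbouring equator points are seen
  from the midpoint of the poles. Order q squared, rather than q, is needed because a primitive q-th
  root of unity has degree q - 1, which may have small prime factors only. Order q squared puts q
  itself into the degree, and since q exceeds d and 2, neither a step of the tower nor the final
  quadratic step can contribute it. In the radical model a degree count proves nothing, because k is
  arbitrary. The obstruction is that all values stay real. The cubic has a cyclic Galois group, so
  one root brings in the others; a real cubic field of this kind contains no new cube root of a base
  element, whereas norms would produce one from the radical. Real fields are treated as sets of
  complex numbers so that \<zeta> can be adjoined within the same type.\<close>

section \<open>Finite extensions in a type of class field\<close>

hide_const (open) Divisibility.prime module.smult up_ring.coeff up_ring.monom Polynomials.degree Polynomials.lead_coeff

text \<open>Turns the whole type into a record-based ring, so that the theory of dimension and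
  algebraic elements over subfields applies to sets of elements of the type.\<close>

definition type_ring :: "'a::field ring" ("\<R>") where
  "\<R> = \<lparr>carrier = UNIV, monoid.mult = (*), one = 1, ring.zero = 0, add = (+)\<rparr>"

lemma type_ring_field: "field (\<R> :: 'a::field ring)"
proof -
  have "\<exists>y. x + y = 0" for x :: 'a
    using add.right_inverse by blast
  moreover have "x \<noteq> 0 \<Longrightarrow> \<exists>y. x * y = 1" for x :: 'a
    by (rule exI[of _ "inverse x"]) auto
  ultimately show ?thesis
    unfolding type_ring_def using add.right_inverse
    by unfold_locales (auto simp: algebra_simps Units_def)
qed

interpretation TR: domain "\<R> :: 'a::field ring"
  by (rule field.axioms(1)[OF type_ring_field])

lemma type_ring_simps [simp]:
  "carrier \<R> = UNIV" "\<one>\<^bsub>\<R>\<^esub> = 1" "\<zero>\<^bsub>\<R>\<^esub> = 0"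
  "x \<oplus>\<^bsub>\<R>\<^esub> y = x + y" "x \<otimes>\<^bsub>\<R>\<^esub> y = x * y"
  by (simp_all add: type_ring_def)

lemma type_ring_uminus [simp]: "\<ominus>\<^bsub>\<R>\<^esub> x = - x"
  by (rule TR.add.inv_equality) auto

lemma type_ring_inv [simp]: "x \<noteq> 0 \<Longrightarrow> inv\<^bsub>\<R>\<^esub> x = inverse x"
  using TR.comm_inv_char[of x "inverse x"] by auto

lemma type_ring_pow [simp]: "x [^]\<^bsub>\<R>\<^esub> (n::nat) = x ^ n"
  by (induction n) (auto simp: mult.commute)

text \<open>\<open>inverse 0 = 0\<close>, so closure under inverse needs no exception at 0; and 0
  itself arises as \<open>1 - 1\<close>.\<close>

definition is_subfield :: "'a::field set \<Rightarrow> bool" where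
  "is_subfield K \<longleftrightarrow> 1 \<in> K \<and> (\<forall>x\<in>K. \<forall>y\<in>K. x - y \<in> K \<and> x * y \<in> K) \<and> (\<forall>x\<in>K. inverse x \<in> K)"

context
  fixes K :: "'a::field set"
  assumes K: "is_subfield K"
begin

lemma is_subfieldD:
  shows "1 \<in> K" and "0 \<in> K" and "x \<in> K \<Longrightarrow> y \<in> K \<Longrightarrow> x - y \<in> K"
    and "x \<in> K \<Longrightarrow> y \<in> K \<Longrightarrow> x + y \<in> K" and "x \<in> K \<Longrightarrow> - x \<in> K"
    and "x \<in> K \<Longrightarrow> y \<in> K \<Longrightarrow> x * y \<in> K" and "x \<in> K \<Longrightarrow> inverse x \<in> K"
    and "x \<in> K \<Longrightarrow> y \<in> K \<Longrightarrow> x / y \<in> K" and "x \<in> K \<Longrightarrow> x ^ n \<in> K"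
proof -
  show 1: "1 \<in> K" and d: "\<And>x y. x \<in> K \<Longrightarrow> y \<in> K \<Longrightarrow> x - y \<in> K"
    and m: "\<And>x y. x \<in> K \<Longrightarrow> y \<in> K \<Longrightarrow> x * y \<in> K" and i: "\<And>x. x \<in> K \<Longrightarrow> inverse x \<in> K"
    using K by (auto simp: is_subfield_def)
  from d[OF 1 1] show 0: "0 \<in> K" by simp
  show u: "\<And>x. x \<in> K \<Longrightarrow> - x \<in> K" using d[OF 0] by simp
  show "\<And>x y. x \<in> K \<Longrightarrow> y \<in> K \<Longrightarrow> x + y \<in> K" using d u by (metis diff_minus_eq_add)
  show "\<And>x y. x \<in> K \<Longrightarrow> y \<in> K \<Longrightarrow> x / y \<in> K" using m i by (simp add: field_class.field_divide_inverse)
  show "\<And>x. x \<in> K \<Longrightarrow> x ^ n \<in> K" by (induction n) (auto intro: 1 m)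
qed

lemma is_subfield_sum: "(\<And>i. i \<in> A \<Longrightarrow> f i \<in> K) \<Longrightarrow> sum f A \<in> K"
  by (induction A rule: infinite_finite_induct) (auto intro: is_subfieldD)

lemma subfield_type_ring: "subfield K \<R>"
proof (rule field.subfieldI'[OF type_ring_field TR.subringI])
  fix k assume k: "k \<in> K - {\<zero>\<^bsub>\<R>\<^esub>}"
  then show "inv\<^bsub>\<R>\<^esub> k \<in> K" by (auto intro: is_subfieldD)
qed (auto intro: is_subfieldD)

end

lemma is_subfieldI: "subfield K (\<R> :: 'a::field ring) \<Longrightarrow> is_subfield K"
proof -
  assume a: "subfield K (\<R> :: 'a ring)"
  note s = subfieldE(1)[OF a]
  have u: "x \<in> K \<Longrightarrow> - x \<in> K" for x using subringE(5)[OF s, of x] by simp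
  have p: "x \<in> K \<Longrightarrow> y \<in> K \<Longrightarrow> x + y \<in> K" for x y using subringE(7)[OF s, of x y] by simp
  have m: "x \<in> K \<Longrightarrow> y \<in> K \<Longrightarrow> x * y \<in> K" for x y using subringE(6)[OF s, of x y] by simp
  have z: "0 \<in> K" "1 \<in> K" using subringE(2,3)[OF s] by auto
  have i: "inverse x \<in> K" if "x \<in> K" for x
    using TR.subfield_m_inv(1)[OF a, of x] that z by (cases "x = 0") auto
  show ?thesis using z m i p u unfolding is_subfield_def by (metis diff_conv_add_uminus)
qed

definition poly_over :: "'a::field set \<Rightarrow> 'a poly \<Rightarrow> bool" where
  "poly_over K p \<longleftrightarrow> (\<forall>i. coeff p i \<in> K)"

definition ext_dim :: "'a::field set \<Rightarrow> 'a set \<Rightarrow> nat \<Rightarrow> bool" where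
  "ext_dim K E n \<longleftrightarrow> ring.dimension \<R> n K E"

definition adjoin :: "'a::field set \<Rightarrow> 'a \<Rightarrow> 'a set" where
  "adjoin K x = {poly p x | p. poly_over K p}"

text \<open>Record-based polynomials are lists with the leading coefficient first and nonzero, while
  \<open>Poly\<close> expects the constant term first; hence the \<open>rev\<close> in every
  translation.\<close>

lemma ring_eval_eq_poly: "ring.eval \<R> p x = poly (Poly (rev p)) x"
  by (induction p) (auto simp: Poly_snoc poly_monom)

lemma univ_poly_carrier_rev:
  assumes "is_subfield K" "poly_over K p"
  shows "rev (coeffs p) \<in> carrier (univ_poly \<R> K)" "Poly (rev (rev (coeffs p))) = p"
proof -
  have "set (coeffs p) \<subseteq> K"
    using assms by (auto simp: poly_over_def coeffs_def)
  moreover have "p \<noteq> 0 \<Longrightarrow> hd (rev (coeffs p)) \<noteq> 0"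
    by (simp add: hd_rev last_coeffs_eq_coeff_degree)
  ultimately show "rev (coeffs p) \<in> carrier (univ_poly \<R> K)"
    unfolding univ_poly_carrier[symmetric] polynomial_def by auto
qed simp

lemma poly_over_Poly_rev:
  assumes "is_subfield K" "p \<in> carrier (univ_poly \<R> K)"
  shows "poly_over K (Poly (rev p))" "p \<noteq> [] \<Longrightarrow> Poly (rev p) \<noteq> 0"
    "degree (Poly (rev p)) = length p - 1"
    "p \<noteq> [] \<Longrightarrow> lead_coeff (Poly (rev p)) = hd p"
proof -
  have p: "set p \<subseteq> K" "p \<noteq> [] \<Longrightarrow> hd p \<noteq> 0"
    using assms(2) unfolding univ_poly_carrier[symmetric] polynomial_def by auto
  have c: "coeffs (Poly (rev p)) = rev p"
  proof -
    have "dropWhile ((=) 0) p = p" using p(2) by (cases p) simp_all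
    then show ?thesis by (simp add: strip_while_def)
  qed
  show "poly_over K (Poly (rev p))"
    unfolding poly_over_def
  proof
    fix i
    have "i < length p \<Longrightarrow> rev p ! i \<in> set p" using nth_mem[of i "rev p"] by simp
    then show "coeff (Poly (rev p)) i \<in> K"
      using p(1) is_subfieldD(2)[OF assms(1)] by (auto simp: nth_default_def)
  qed
  show ne: "p \<noteq> [] \<Longrightarrow> Poly (rev p) \<noteq> 0" by (metis c coeffs_eq_Nil rev_is_Nil_conv)
  show d: "degree (Poly (rev p)) = length p - 1"
    unfolding degree_eq_length_coeffs c by simp
  show "p \<noteq> [] \<Longrightarrow> lead_coeff (Poly (rev p)) = hd p"
    using last_coeffs_eq_coeff_degree[OF ne] unfolding c by (metis last_rev)
qed

lemma simple_extension_type_ring: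
  assumes "is_subfield K"
  shows "ring.simple_extension \<R> K x = adjoin K x"
proof -
  have "ring.simple_extension \<R> K x = (\<lambda>p. ring.eval \<R> p x) ` carrier (univ_poly \<R> K)"
    by (rule TR.simple_extension_as_eval_img) auto
  also have "\<dots> = adjoin K x"
  proof (intro equalityI subsetI)
    fix y assume "y \<in> (\<lambda>p. ring.eval \<R> p x) ` carrier (univ_poly \<R> K)"
    then obtain p where "p \<in> carrier (univ_poly \<R> K)" "y = ring.eval \<R> p x" by blast
    then show "y \<in> adjoin K x"
      unfolding adjoin_def using poly_over_Poly_rev(1)[OF assms] ring_eval_eq_poly by blast
  next
    fix y assume "y \<in> adjoin K x"
    then obtain p where p: "poly_over K p" "y = poly p x" unfolding adjoin_def by blast
    then have "y = ring.eval \<R> (rev (coeffs p)) x"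
      using univ_poly_carrier_rev(2)[OF assms p(1)] by (simp add: ring_eval_eq_poly)
    then show "y \<in> (\<lambda>p. ring.eval \<R> p x) ` carrier (univ_poly \<R> K)"
      using univ_poly_carrier_rev(1)[OF assms p(1)] by blast
  qed
  finally show ?thesis .
qed

lemma adjoin_subset: 
  assumes "is_subfield F" "K \<subseteq> F" "x \<in> F"
  shows "adjoin K x \<subseteq> F"
proof
  fix y assume "y \<in> adjoin K x"
  then obtain p where p: "\<And>i. coeff p i \<in> F" "y = poly p x"
    using assms(2) unfolding adjoin_def poly_over_def by blast
  have "coeff p i * x ^ i \<in> F" for i
    by (rule is_subfieldD(6)[OF assms(1) p(1) is_subfieldD(9)[OF assms(1,3)]])
  then show "y \<in> F"
    unfolding p(2) poly_altdef by (rule is_subfield_sum[OF assms(1)])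
qed

lemma subset_adjoin:
  assumes "is_subfield K" shows "K \<subseteq> adjoin K x" "x \<in> adjoin K x"
proof -
  show "K \<subseteq> adjoin K x"
  proof
    fix k assume "k \<in> K"
    then show "k \<in> adjoin K x"
      using assms unfolding adjoin_def poly_over_def
      by (auto intro!: exI[of _ "[:k:]"] simp: coeff_pCons is_subfieldD split: nat.splits)
  qed
  show "x \<in> adjoin K x"
    using assms unfolding adjoin_def poly_over_def
    by (auto intro!: exI[of _ "[:0, 1:]"] simp: coeff_pCons is_subfieldD split: nat.splits)
qed

text \<open>The nonzero p makes x algebraic. The monic irreducible polynomial \<open>Irr K x\<close>
  supplies the degree, and it divides every annihilating polynomial, which gives minimality.\<close>

lemma adjoin_algebraic:
  assumes K: "is_subfield K" and p: "poly_over K p" "p \<noteq> 0" "poly p x = 0"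
  shows is_subfield_adjoin: "is_subfield (adjoin K x)"
    and ex_minimal_poly: "\<exists>g. poly_over K g \<and> lead_coeff g = 1 \<and> poly g x = 0 \<and>
      ext_dim K (adjoin K x) (degree g) \<and> degree g > 0 \<and>
      (\<forall>h. poly_over K h \<and> h \<noteq> 0 \<and> poly h x = 0 \<longrightarrow> degree g \<le> degree h)"
proof -
  note S = subfield_type_ring[OF K]
  have alg: "(TR.algebraic over K) x"
    by (rule TR.algebraicI[of "rev (coeffs p)"])
      (use p univ_poly_carrier_rev[OF K p(1)] in \<open>auto simp: ring_eval_eq_poly\<close>)
  show "is_subfield (adjoin K x)"
    using TR.simple_extension_is_subfield[OF S, of x] alg simple_extension_type_ring[OF K]
    by (metis UNIV_I is_subfieldI type_ring_simps(1))
  let ?I = "TR.Irr K x" let ?g = "Poly (rev ?I)"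
  note I = TR.IrrE[OF S _ alg, simplified]
  have ne: "?I \<noteq> []"
    using I(2) TR.pirreducibleE(1)[OF subfieldE(1)[OF S] I(1)] by auto
  have deg: "degree ?g = length ?I - 1" using poly_over_Poly_rev[OF K I(1)] by simp
  have d: "ext_dim K (adjoin K x) (degree ?g)"
    unfolding ext_dim_def using TR.dimension_simple_extension[OF S _ alg]
    by (simp add: deg simple_extension_type_ring[OF K])
  have pos: "degree ?g > 0" 
    using TR.pirreducible_degree[OF S I(1,2)] deg by simp
  have min: "degree ?g \<le> degree h"
    if h: "poly_over K h" "h \<noteq> 0" "poly h x = 0" for h
  proof -
    note c = univ_poly_carrier_rev[OF K h(1)]
    have "?I pdivides\<^bsub>\<R>\<^esub> (rev (coeffs h))"
      by (rule TR.Irr_minimal[OF S _ alg c(1)]) (use h in \<open>auto simp: ring_eval_eq_poly\<close>)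
    from TR.pdivides_imp_degree_le[OF subfieldE(1)[OF S] I(1) c(1) _ this] h(2)
    show ?thesis unfolding deg degree_eq_length_coeffs[of h] by simp
  qed
  show "\<exists>g. poly_over K g \<and> lead_coeff g = 1 \<and> poly g x = 0 \<and>
      ext_dim K (adjoin K x) (degree g) \<and> degree g > 0 \<and>
      (\<forall>h. poly_over K h \<and> h \<noteq> 0 \<and> poly h x = 0 \<longrightarrow> degree g \<le> degree h)"
  proof (intro exI[of _ ?g] conjI allI impI)
    show "lead_coeff ?g = 1" using poly_over_Poly_rev(4)[OF K I(1) ne] I(3) by (simp only:)
    show "poly ?g x = 0" using I(4) by (simp only: ring_eval_eq_poly)
  qed (use d pos min poly_over_Poly_rev(1)[OF K I(1)] in auto)
qed

lemma ext_dim_tower: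
  assumes "is_subfield K" "is_subfield F" "ext_dim K F m" "ext_dim F E n"
  shows "ext_dim K E (m * n)"
  using TR.telescopic_base[OF subfield_type_ring subfield_type_ring] assms by (auto simp: ext_dim_def)

lemma ext_dim_unique:
  assumes "is_subfield K" "ext_dim K E m" "ext_dim K E n"
  shows "m = n"
  using TR.dimension_is_inj[OF subfield_type_ring] assms by (auto simp: ext_dim_def)

lemma ext_dim_self: "is_subfield K \<Longrightarrow> ext_dim K K 1"
  unfolding ext_dim_def by (rule TR.dimension_one[OF subfield_type_ring])

text \<open>Converse of the tower law: a K-basis of E also spans E over F, and F is a K-subspace of
  the finite-dimensional E, so both partial degrees exist; uniqueness of dimension gives the
  product.\<close>

lemma ext_dim_tower_split:
  assumes K: "is_subfield K" and F: "is_subfield F" and E: "is_subfield E"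
    and sub: "K \<subseteq> F" "F \<subseteq> E" and n: "ext_dim K E n"
  obtains a b where "ext_dim K F a" "ext_dim F E b" "n = a * b"
proof -
  note SK = subfield_type_ring[OF K] and SF = subfield_type_ring[OF F] and SE = subfield_type_ring[OF E]
  have sub_alg: "subalgebra A B \<R>" if "is_subfield B" "A \<subseteq> B" for A B :: "'a set"
  proof -
    have "subring B \<R>" using subfieldE(1)[OF subfield_type_ring[OF that(1)]] .
    then have "subgroup B (add_monoid \<R>)"
      by (rule subring.axioms(1))
    then show ?thesis using that
      by (auto simp: subalgebra_def subalgebra_axioms_def is_subfield_def)
  qed
  obtain Us where Us: "ring.Span \<R> K Us = E"
    using TR.exists_base[OF SK] n unfolding ext_dim_def by blast
  have UsE: "set Us \<subseteq> E" using TR.Span_base_incl[OF SK, of Us] Us by simp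
  have "ring.Span \<R> F Us \<subseteq> E"
    by (rule TR.subalgebra_Span_incl[OF SF sub_alg[OF E sub(2)] UsE])
  moreover have "subalgebra K (ring.Span \<R> F Us) \<R>"
    using TR.Span_is_subalgebra[OF SF, of Us] sub(1) by (auto simp: subalgebra_def subalgebra_axioms_def)
  then have "ring.Span \<R> K Us \<subseteq> ring.Span \<R> F Us"
    by (rule TR.subalgebra_Span_incl[OF SK]) (rule TR.Span_base_incl[OF SF], simp)
  ultimately have "ring.Span \<R> F Us = E" using Us by blast
  then have "TR.finite_dimension F E" using TR.Span_finite_dimension[OF SF, of Us] by simp
  then obtain b where b: "ext_dim F E b" by (auto simp: TR.finite_dimension_def ext_dim_def)
  have "TR.finite_dimension K F"
    by (rule TR.subalbegra_incl_imp_finite_dimension[OF SK _ sub_alg[OF F sub(1)] sub(2)])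
      (use n in \<open>auto simp: TR.finite_dimension_def ext_dim_def\<close>)
  then obtain a where a: "ext_dim K F a" by (auto simp: TR.finite_dimension_def ext_dim_def)
  show thesis using that[OF a b] ext_dim_tower[OF K F a b] ext_dim_unique[OF K n] by blast
qed

section \<open>Degree of roots of unity of prime square order\<close>

text \<open>Let i be the least index at which f has a coefficient not divisible by q. As q does not
  divide the constant term of g either, coefficient i of \<open>f * g\<close> is not divisible by q.
  Only the top one has this property, so f already has the full degree.\<close>

lemma eisenstein_aux:
  fixes f g :: "int poly"
  assumes q: "prime q" and dvd: "\<And>i. i < degree (f * g) \<Longrightarrow> q dvd coeff (f * g) i"
    and lead: "\<not> q dvd lead_coeff (f * g)" and f0: "q dvd coeff f 0" and g0: "\<not> q dvd coeff g 0"
  shows "degree g = 0"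
proof -
  have fg: "f * g \<noteq> 0" using lead by auto
  have "\<not> q dvd lead_coeff f" using lead by (auto simp: lead_coeff_mult)
  define i where "i = (LEAST i. \<not> q dvd coeff f i)"
  have i: "\<not> q dvd coeff f i"
    unfolding i_def by (rule LeastI) fact
  have le: "i \<le> degree f"
    unfolding i_def by (rule Least_le) fact
  have less: "q dvd coeff f j" if "j < i" for j
    using not_less_Least[OF that[unfolded i_def]] by simp
  have "coeff (f * g) i = coeff f i * coeff g 0 + (\<Sum>j<i. coeff f j * coeff g (i - j))"
    by (simp add: coeff_mult lessThan_Suc_atMost[symmetric] add.commute)
  moreover have "q dvd (\<Sum>j<i. coeff f j * coeff g (i - j))"
    by (intro dvd_sum dvd_mult2 less) simp
  moreover have "\<not> q dvd coeff f i * coeff g 0"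
    using i g0 q by (simp add: prime_dvd_mult_iff)
  ultimately have "\<not> q dvd coeff (f * g) i" by (simp add: dvd_add_left_iff)
  then have "degree (f * g) \<le> i" using dvd[of i] by linarith
  then show ?thesis using le fg by (simp add: degree_mult_eq)
qed

text \<open>Unless the product is constant, its constant term is divisible by q but not by the
  square of q, so exactly one factor has a constant term divisible by q; the other factor is then
  constant.\<close>

lemma eisenstein:
  fixes f g :: "int poly"
  assumes q: "prime q" and dvd: "\<And>i. i < degree (f * g) \<Longrightarrow> q dvd coeff (f * g) i"
    and lead: "\<not> q dvd lead_coeff (f * g)" and sq: "\<not> q\<^sup>2 dvd coeff (f * g) 0"
  shows "degree f = 0 \<or> degree g = 0"
proof (cases "degree (f * g) = 0")
  case True
  then show ?thesis using lead by (auto simp: degree_mult_eq_0)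
next
  case False
  have c0: "coeff (f * g) 0 = coeff f 0 * coeff g 0" by (simp add: coeff_mult)
  then have "q dvd coeff f 0 \<or> q dvd coeff g 0"
    using dvd[of 0] False q by (simp add: prime_dvd_mult_iff)
  moreover have "\<not> (q dvd coeff f 0 \<and> q dvd coeff g 0)"
    using sq unfolding c0 power2_eq_square by (auto intro: mult_dvd_mono)
  ultimately show ?thesis
    using eisenstein_aux[of q f g] eisenstein_aux[of q g f] assms by (auto simp: mult.commute)
qed

abbreviation ipoly :: "int poly \<Rightarrow> 'a::field_char_0 \<Rightarrow> 'a" where
  "ipoly p x \<equiv> poly (map_poly of_int p) x"

lemma ipoly_simps [simp]:
  "ipoly (p + q) x = ipoly p x + ipoly q x" "ipoly (p * q) x = ipoly p x * ipoly q x"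
  "ipoly (smult a p) x = of_int a * ipoly p x"
proof -
  have "map_poly of_int (p + q) = map_poly of_int p + (map_poly of_int q :: 'a poly)"
    by (rule poly_eqI) (simp add: coeff_map_poly)
  then show "ipoly (p + q) x = ipoly p x + ipoly q x" by simp
  have "map_poly of_int (p * q) = map_poly of_int p * (map_poly of_int q :: 'a poly)"
    by (rule poly_eqI) (simp add: coeff_map_poly coeff_mult)
  then show "ipoly (p * q) x = ipoly p x * ipoly q x" by simp
  have "map_poly of_int (smult a p) = smult (of_int a) (map_poly of_int p :: 'a poly)"
    by (rule poly_eqI) (simp add: coeff_map_poly)
  then show "ipoly (smult a p) x = of_int a * ipoly p x" by simp
qed

text \<open>Descent by pseudo-division of G by H. A nonzero remainder annihilates x and has smaller
  degree than H; a zero remainder yields a factorization of G, which Eisenstein's criterion makes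
  trivial.\<close>

lemma eisenstein_degree_le:
  fixes G H :: "int poly" and x :: "'a::field_char_0"
  assumes q: "prime q" and G: "lead_coeff G = 1" "\<And>i. i < degree G \<Longrightarrow> q dvd coeff G i"
    "\<not> q\<^sup>2 dvd coeff G 0" "ipoly G x = 0"
    and H: "H \<noteq> 0" "ipoly H x = 0"
  shows "degree G \<le> degree H"
  using H
proof (induction "degree H" arbitrary: H rule: less_induct)
  case less
  obtain a p where ap: "a \<noteq> 0" "smult a G = H * p + pseudo_mod G H"
    using pseudo_mod(1)[OF less.prems(1)] by blast
  let ?r = "pseudo_mod G H"
  have r: "?r = 0 \<or> degree ?r < degree H" using pseudo_mod(2)[OF less.prems(1)] .
  have "ipoly ?r x = ipoly (smult a G) x - ipoly (H * p) x" unfolding ap(2) by simp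
  then have "ipoly ?r x = 0" using G(4) less.prems by simp
  show ?case
  proof (cases "?r = 0")
    case False
    then show ?thesis using less.hyps[of ?r] r \<open>ipoly ?r x = 0\<close> by auto
  next
    case True
    have "content G = 1"
      using G(1) content_dvd_coeff[of G "degree G"] by (simp flip: is_unit_content_iff)
    \<comment> \<open>Gauss's lemma: passing to primitive parts removes the multiplier a up to sign,
      which leaves an integral factorization of G or its negative.\<close>
    have "smult (unit_factor a) G = primitive_part (smult a G)"
      using \<open>content G = 1\<close> by (simp add: primitive_part_smult primitive_part_prim)
    also have "\<dots> = primitive_part H * primitive_part p"
      using ap True by (simp add: primitive_part_mult)
    finally have eq: "smult (unit_factor a) G = primitive_part H * primitive_part p" .
    have u: "unit_factor a = 1 \<or> unit_factor a = -1" using ap(1) by (auto simp: sgn_if)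
    then have deg: "degree (primitive_part H * primitive_part p) = degree G" unfolding eq[symmetric] by auto
    have "degree (primitive_part H) = 0 \<or> degree (primitive_part p) = 0"
      by (rule eisenstein[OF q]) (use u G q in \<open>auto simp flip: eq simp: dvd_smult_iff\<close>)
    moreover have "degree H \<noteq> 0"
    proof
      assume "degree H = 0"
      then obtain c where "H = [:c:]" by (rule degree_eq_zeroE)
      then show False using less.prems by (simp add: map_poly_pCons)
    qed
    moreover have "degree G = degree (primitive_part H) + degree (primitive_part p)"
      using ap True G(1) degree_mult_eq[of "primitive_part H" "primitive_part p"] deg by fastforce
    ultimately show ?thesis by simp
  qed
qed

lemma ex_int_poly_of_Rats:
  fixes h :: "'a::field_char_0 poly"
  assumes "\<And>i. coeff h i \<in> \<rat>"
  shows "\<exists>d H. d \<noteq> 0 \<and> map_poly of_int H = smult (of_int d) h"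
  using assms
proof (induction h)
  case 0
  show ?case by (intro exI[of _ 1] exI[of _ 0]) simp
next
  case (pCons a h)
  have "coeff h i \<in> \<rat>" for i using pCons.prems[of "Suc i"] by simp
  then obtain d H where dH: "d \<noteq> 0" "map_poly of_int H = smult (of_int d) h"
    using pCons.IH by blast
  have "a \<in> \<rat>" using pCons.prems[of 0] by simp
  then obtain m k :: int where mk: "k \<noteq> 0" "a = of_int m / of_int k"
    by (metis Rats_cases' not_less_iff_gr_or_eq)
  have "map_poly of_int (pCons (m * d) (smult k H)) = smult (of_int (k * d)) (pCons a h)"
    using dH mk by (intro poly_eqI)
      (auto simp: coeff_map_poly coeff_pCons poly_eq_iff field_simps split: nat.splits)
  then show ?case using dH(1) mk(1) by (metis no_zero_divisors)
qed

text \<open>The inner binomial coefficients are multiples of q. Stated as divisibility in any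
  commutative ring, so that it applies to integer polynomials without passing to a quotient.\<close>

lemma freshman_dvd:
  fixes a b :: "'a::comm_ring_1"
  assumes q: "prime q"
  shows "of_nat q dvd (a + b) ^ q - (a ^ q + b ^ q)"
proof -
  have q0: "q > 0" using q prime_gt_0_nat by blast
  have "(a + b) ^ q = (\<Sum>k\<le>q. of_nat (q choose k) * a ^ k * b ^ (q - k))"
    by (rule binomial_ring)
  also have "{..q} = insert 0 (insert q {0<..<q})" using q0 by auto
  finally have "(a + b) ^ q - (a ^ q + b ^ q) = (\<Sum>k\<in>{0<..<q}. of_nat (q choose k) * a ^ k * b ^ (q - k))"
    using q0 by simp
  moreover have "of_nat q dvd (of_nat (q choose k) :: 'a)" if "k \<in> {0<..<q}" for k
  proof -
    have "q dvd (q choose k)" using that q q0 by (intro dvd_choose_prime) auto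
    then show ?thesis by (auto elim!: dvdE)
  qed
  then have "of_nat q dvd (\<Sum>k\<in>{0<..<q}. of_nat (q choose k) * a ^ k * b ^ (q - k))"
    by (intro dvd_sum dvd_mult2) auto
  ultimately show ?thesis by simp
qed

lemma dvd_power_diff: "m dvd a - b \<Longrightarrow> m dvd a ^ k - (b :: 'a::comm_ring_1) ^ k"
  by (metis dvd_trans dvd_triv_left power_diff_sumr2)

text \<open>For prime \<open>q\<close>, the cyclotomic polynomial of order \<open>q\<^sup>2\<close> at \<open>x + 1\<close>, which makes it Eisenstein at \<open>q\<close>.\<close>

definition cyclotomic_shift :: "nat \<Rightarrow> int poly" where
  "cyclotomic_shift q = (\<Sum>j<q. ([:1, 1:] ^ q) ^ j)"

lemma degree_cyclotomic_shift: 
  assumes "q > 0" shows "degree (cyclotomic_shift q) = q * (q - 1)" "lead_coeff (cyclotomic_shift q) = 1"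
proof -
  have d: "degree (([:1, 1:] ^ q) ^ j :: int poly) = q * j" for j
    by (simp add: degree_power_eq)
  have l: "lead_coeff (([:1, 1:] ^ q) ^ j :: int poly) = 1" for j
    unfolding lead_coeff_power by simp
  note m = d l
  define R :: "int poly" where "R = (\<Sum>j<q - 1. ([:1, 1:] ^ q) ^ j)"
  have c: "cyclotomic_shift q = ([:1, 1:] ^ q) ^ (q - 1) + R"
    using assms sum.lessThan_Suc[of "\<lambda>j. ([:1, 1:] ^ q) ^ j" "q - 1"] by (simp add: cyclotomic_shift_def R_def add.commute)
  have "degree R < q * (q - 1) \<or> R = 0"
  proof (cases "q = 1")
    case True then show ?thesis by (simp add: R_def)
  next
    case False
    then have "q * (q - 1) > 0" using assms by simp
    then have "degree R < q * (q - 1)"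
      unfolding R_def using assms by (intro degree_sum_less) (auto simp: m)
    then show ?thesis ..
  qed
  then have R: "degree R < degree (([:1, 1:] ^ q) ^ (q - 1) :: int poly) \<or> R = 0"
    unfolding d .
  then show deg: "degree (cyclotomic_shift q) = q * (q - 1)"
    unfolding c using degree_add_eq_left[of R] d by (metis add.right_neutral)
  have "coeff R (q * (q - 1)) = 0" using R unfolding d by (auto intro: coeff_eq_0)
  then show "lead_coeff (cyclotomic_shift q) = 1"
    unfolding deg unfolding c using l[of "q - 1"] unfolding d by simp
qed

text \<open>Modulo q, \<open>(1 + Y) ^ q\<close> becomes \<open>Y ^ q + 1\<close>. The geometric sum
  S of the powers of the latter satisfies \<open>Y ^ q * S = (Y ^ q + 1) ^ q - 1\<close>, which is
  congruent to \<open>Y ^ (q * q)\<close>. So the polynomial is congruent to its leading term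
  \<open>Y ^ (q * (q - 1))\<close>.\<close>

lemma prime_dvd_coeff_cyclotomic_shift:
  assumes q: "prime q" and i: "i < q * (q - 1)"
  shows "int q dvd coeff (cyclotomic_shift q) i"
proof -
  have q0: "q > 0" using q prime_gt_0_nat by blast
  define Y :: "int poly" where "Y = [:0, 1:]"
  let ?q = "of_nat q :: int poly"
  have X1: "[:1, 1:] = Y + 1" by (simp add: Y_def one_pCons)
  have w: "?q dvd [:1, 1:] ^ q - (Y ^ q + 1)" using freshman_dvd[OF q, of Y 1] by (simp add: X1)
  define S where "S = (\<Sum>j<q. (Y ^ q + 1) ^ j)"
  have 1: "?q dvd cyclotomic_shift q - S"
    unfolding cyclotomic_shift_def S_def sum_subtractf[symmetric] by (intro dvd_sum dvd_power_diff w)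
  have "Y ^ q * S = (Y ^ q + 1) ^ q - 1"
    using power_diff_1_eq[of "Y ^ q + 1" q] by (simp add: S_def)
  moreover have "?q dvd (Y ^ q + 1) ^ q - ((Y ^ q) ^ q + 1)" using freshman_dvd[OF q, of "Y ^ q" 1] by simp
  ultimately have "?q dvd Y ^ q * S - (Y ^ q) ^ q" by (simp only: diff_diff_eq add.commute)
  moreover have "(Y ^ q) ^ q = Y ^ q * (Y ^ q) ^ (q - 1)" using q0 by (cases q) simp_all
  ultimately have "?q dvd Y ^ q * S - Y ^ q * (Y ^ q) ^ (q - 1)" by (simp only:)
  then have "?q dvd Y ^ q * (S - Y ^ (q * (q - 1)))" by (simp only: power_mult right_diff_distrib)
  moreover have "?q dvd Y ^ q * (cyclotomic_shift q - S)" using 1 by simp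
  ultimately have "?q dvd Y ^ q * (S - Y ^ (q * (q - 1))) + Y ^ q * (cyclotomic_shift q - S)" by (rule dvd_add)
  \<comment> \<open>Divisibility by a constant polynomial is coefficientwise, and the factor
    \<open>monom 1 q\<close> only shifts indices by q; reading off coefficient \<open>q + i\<close>
    thus cancels it.\<close>
  then have "[:int q:] dvd monom 1 q * (cyclotomic_shift q - monom 1 (q * (q - 1)))"
    by (simp add: Y_def monom_altdef of_nat_poly algebra_simps)
  then have "int q dvd coeff (monom 1 q * (cyclotomic_shift q - monom 1 (q * (q - 1)))) (q + i)"
    by (simp only: const_poly_dvd_iff)
  then show ?thesis using i by (simp add: coeff_monom_mult)
qed

lemma degree_ge_of_root_of_unity:
  fixes \<zeta> :: "'a::field_char_0" and h :: "'a poly"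
  assumes q: "prime q" and z: "\<zeta> ^ q\<^sup>2 = 1" "\<zeta> ^ q \<noteq> 1"
    and h: "\<And>i. coeff h i \<in> \<rat>" "h \<noteq> 0" "poly h \<zeta> = 0"
  shows "q * (q - 1) \<le> degree h"
proof -
  have q0: "q > 0" using q prime_gt_0_nat by blast
  obtain d H where dH: "d \<noteq> 0" "map_poly of_int H = smult (of_int d) h"
    using ex_int_poly_of_Rats[OF h(1)] by blast
  \<comment> \<open>The Eisenstein polynomial vanishes at \<zeta> - 1, so H is shifted by 1 as well;
    this keeps its degree.\<close>
  define K where "K = H \<circ>\<^sub>p [:1, 1:]"
  have pcomp: "ipoly (p \<circ>\<^sub>p [:1, 1:]) (\<zeta> - 1) = ipoly p \<zeta>" for p
    by (induction p) (simp_all add: pcompose_pCons map_poly_pCons algebra_simps)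
  have "degree (map_poly of_int H :: 'a poly) = degree H" by (rule degree_map_poly) simp
  then have degH: "degree H = degree h" using dH by simp
  have "H \<noteq> 0" using dH h(2) by auto
  then have K: "K \<noteq> 0" "degree K = degree h"
    by (auto simp: K_def pcompose_eq_0_iff degree_pcompose degH)
  have "ipoly K (\<zeta> - 1) = 0" unfolding K_def pcomp dH(2) using h(3) by simp
  moreover have "ipoly (cyclotomic_shift q) (\<zeta> - 1) = 0"
  proof -
    have pw: "ipoly ([:1, 1:] ^ k) (\<zeta> - 1) = \<zeta> ^ k" for k
      by (induction k) (simp_all add: map_poly_pCons algebra_simps)
    have sm: "ipoly (sum f A) x = (\<Sum>a\<in>A. ipoly (f a) x)" for f :: "nat \<Rightarrow> int poly" and A and x :: 'a
      by (induction A rule: infinite_finite_induct) auto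
    have "ipoly (cyclotomic_shift q) (\<zeta> - 1) = (\<Sum>j<q. (\<zeta> ^ q) ^ j)"
      unfolding cyclotomic_shift_def sm power_mult[symmetric] pw ..
    moreover have "(\<zeta> ^ q - 1) * (\<Sum>j<q. (\<zeta> ^ q) ^ j) = 0"
      using power_diff_1_eq[of "\<zeta> ^ q" q] z(1) by (simp add: power2_eq_square power_mult)
    ultimately show ?thesis using z(2) by simp
  qed
  \<comment> \<open>At 0 each of the q summands is a power of 1.\<close>
  moreover have "coeff (cyclotomic_shift q) 0 = int q"
    by (simp add: cyclotomic_shift_def poly_0_coeff_0[symmetric] poly_sum poly_power)
  moreover have "\<not> (int q)\<^sup>2 dvd int q"
  proof -
    have "\<not> q\<^sup>2 dvd q" using q prime_gt_1_nat[OF q] by (auto dest!: dvd_imp_le simp: power2_eq_square)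
    then show ?thesis by (metis of_nat_power of_nat_dvd_iff)
  qed
  ultimately have "degree (cyclotomic_shift q) \<le> degree K"
    using q degree_cyclotomic_shift[OF q0] prime_dvd_coeff_cyclotomic_shift[OF q] K(1) by (intro eisenstein_degree_le[of "int q"]) auto
  then show ?thesis using degree_cyclotomic_shift[OF q0] K(2) by simp
qed

section \<open>Polynomial division and minimal polynomials over a subfield\<close>

lemma is_subfield_Rats: "is_subfield (\<rat> :: 'a::field_char_0 set)"
  by (auto simp: is_subfield_def)

lemma is_subfield_Reals: "is_subfield (\<real> :: complex set)"
  by (auto simp: is_subfield_def)

lemma Rats_subset_subfield:
  fixes K :: "'a::field_char_0 set"
  assumes K: "is_subfield K" shows "\<rat> \<subseteq> K"
proof
  have nat: "of_nat n \<in> K" for n by (induction n) (auto intro: is_subfieldD[OF K])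
  have int: "of_int i \<in> K" for i
    by (cases i rule: int_cases2) (auto intro: nat is_subfieldD(5)[OF K])
  fix x :: 'a assume "x \<in> \<rat>"
  then obtain a b :: int where "x = of_int a / of_int b" by (metis Rats_cases')
  then show "x \<in> K" using int is_subfieldD(8)[OF K] by blast
qed

lemma poly_over_simps:
  assumes K: "is_subfield K"
  shows "poly_over K 0" "poly_over K (pCons a p) \<longleftrightarrow> a \<in> K \<and> poly_over K p"
    "poly_over K p \<Longrightarrow> poly_over K q \<Longrightarrow> poly_over K (p + q)"
    "poly_over K p \<Longrightarrow> poly_over K q \<Longrightarrow> poly_over K (p - q)"
    "a \<in> K \<Longrightarrow> poly_over K p \<Longrightarrow> poly_over K (smult a p)"
    "poly_over K p \<Longrightarrow> poly_over K q \<Longrightarrow> poly_over K (p * q)"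
    "a \<in> K \<Longrightarrow> poly_over K (monom a k)"
proof -
  show "poly_over K (pCons a p) \<longleftrightarrow> a \<in> K \<and> poly_over K p"
    unfolding poly_over_def by (metis coeff_pCons_0 coeff_pCons_Suc not0_implies_Suc)
  show "poly_over K p \<Longrightarrow> poly_over K q \<Longrightarrow> poly_over K (p * q)"
    unfolding poly_over_def coeff_mult using K by (auto intro: is_subfield_sum is_subfieldD(6))
qed (use is_subfieldD[OF K] in \<open>auto simp: poly_over_def\<close>)

lemma poly_in_subfield:
  assumes "is_subfield K" "poly_over K p" "x \<in> K"
  shows "poly p x \<in> K"
  using assms(2,3)
proof (induction p)
  case 0
  then show ?case by (simp add: is_subfieldD(2)[OF assms(1)])
next
  case (pCons a p)
  then have "a \<in> K" "poly p x \<in> K" by (auto simp: poly_over_simps[OF assms(1)])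
  then show ?case
    using is_subfieldD(4)[OF assms(1) _ is_subfieldD(6)[OF assms(1) assms(3)]] by simp
qed

text \<open>As g is monic, each step subtracts a multiple of g whose factor c is a coefficient of
  the current remainder, so quotient and remainder keep their coefficients in K.\<close>

lemma poly_over_division:
  assumes K: "is_subfield K" and g: "poly_over K g" "lead_coeff g = 1" "degree g > 0"
    and p: "poly_over K p"
  obtains q r where "p = q * g + r" "poly_over K q" "poly_over K r" "degree r < degree g"
  using p
proof (induction p arbitrary: thesis)
  case 0
  show ?case by (rule 0(1)[of 0 0]) (use g poly_over_simps(1)[OF K] in auto)
next
  case (pCons a p)
  have "poly_over K p" and a: "a \<in> K" using pCons.prems(2) by (auto simp: poly_over_simps[OF K])
  then obtain q r where qr: "p = q * g + r" "poly_over K q" "poly_over K r" "degree r < degree g"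
    using pCons.IH by blast
  define c where "c = coeff (pCons a r) (degree g)"
  have r': "poly_over K (pCons a r)" using qr(3) a by (simp add: poly_over_simps[OF K])
  then have c: "c \<in> K" by (simp add: c_def poly_over_def)
  let ?r = "pCons a r - smult c g" and ?q = "pCons c q"
  have eq: "pCons a p = ?q * g + ?r" unfolding qr(1) by (simp add: algebra_simps)
  have "degree ?r \<le> degree g"
    using qr(4) by (intro degree_diff_le) (auto intro: order.trans[OF degree_pCons_le])
  moreover have "coeff ?r (degree g) = 0" using g(2) by (simp add: c_def)
  ultimately have "?r = 0 \<or> degree ?r < degree g" by (rule eq_zero_or_degree_less)
  then have "degree ?r < degree g" using g(3) by (elim disjE) (simp_all only: degree_0)
  then show ?case
    using pCons.prems(1)[OF eq] qr c g r' by (simp add: poly_over_simps[OF K])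
qed

text \<open>Expressed by least degree, since the later contradictions come from annihilating
  polynomials that are too short.\<close>

definition min_poly_over :: "'a::field set \<Rightarrow> 'a \<Rightarrow> 'a poly \<Rightarrow> bool" where
  "min_poly_over K x g \<longleftrightarrow> poly_over K g \<and> lead_coeff g = 1 \<and> poly g x = 0 \<and> degree g > 0 \<and>
     (\<forall>h. poly_over K h \<and> h \<noteq> 0 \<and> poly h x = 0 \<longrightarrow> degree g \<le> degree h)"

lemma min_poly_over_dvd:
  assumes K: "is_subfield K" and g: "min_poly_over K x g" and h: "poly_over K h" "poly h x = 0"
  shows "g dvd h"
proof -
  have g': "poly_over K g" "lead_coeff g = 1" "poly g x = 0" "degree g > 0"
    using g by (auto simp: min_poly_over_def)
  obtain q r where qr: "h = q * g + r" "poly_over K r" "degree r < degree g"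
    by (rule poly_over_division[OF K g'(1,2,4) h(1)])
  have "poly r x = 0" using h(2) g'(3) by (simp add: qr(1))
  then have "r = 0" using g qr unfolding min_poly_over_def by (metis not_less)
  then show ?thesis by (simp add: qr(1))
qed

lemma ex_min_poly_over:
  assumes "is_subfield K" "poly_over K p" "p \<noteq> 0" "poly p x = 0"
  obtains g where "min_poly_over K x g" "ext_dim K (adjoin K x) (degree g)" "degree g \<le> degree p"
  using ex_minimal_poly[OF assms] assms unfolding min_poly_over_def by blast

section \<open>Real fields of degree prime to q\<close>

text \<open>The invariant of the root model. As q is prime, numbers not divisible by q are closed
  under products, so the condition passes up a tower.\<close>

definition rat_degree_coprime :: "nat \<Rightarrow> complex set \<Rightarrow> bool" where
  "rat_degree_coprime q L \<longleftrightarrow> is_subfield L \<and> L \<subseteq> \<real> \<and> (\<exists>N. ext_dim \<rat> L N \<and> \<not> q dvd N)"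

lemma rat_degree_coprime_Rats:
  assumes "prime q" shows "rat_degree_coprime q \<rat>"
proof -
  have "\<not> q dvd 1" using assms not_prime_unit by blast
  moreover have "(\<rat> :: complex set) \<subseteq> \<real>" using Rats_subset_subfield[OF is_subfield_Reals] .
  ultimately show ?thesis
    using ext_dim_self[OF is_subfield_Rats] is_subfield_Rats unfolding rat_degree_coprime_def by blast
qed

text \<open>The degree of x over L lies between 1 and \<open>degree p\<close>, hence below q, and so
  is not divisible by q.\<close>

lemma rat_degree_coprime_adjoin:
  assumes q: "prime q" and L: "rat_degree_coprime q L"
    and p: "poly_over L p" "p \<noteq> 0" "poly p x = 0" "degree p < q" and x: "x \<in> \<real>"
  shows "rat_degree_coprime q (adjoin L x)"
proof -
  obtain N where N: "is_subfield L" "L \<subseteq> \<real>" "ext_dim \<rat> L N" "\<not> q dvd N"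
    using L by (auto simp: rat_degree_coprime_def)
  obtain g where g: "min_poly_over L x g" "ext_dim L (adjoin L x) (degree g)" "degree g \<le> degree p"
    using ex_min_poly_over[OF N(1) p(1-3)] by blast
  have "degree g > 0" using g(1) by (simp add: min_poly_over_def)
  then have "\<not> q dvd degree g" using g(3) p(4) by (auto dest: dvd_imp_le)
  then have "\<not> q dvd N * degree g" using N(4) q by (simp add: prime_dvd_mult_iff)
  then show ?thesis
    using ext_dim_tower[OF is_subfield_Rats N(1,3) g(2)] is_subfield_adjoin[OF N(1) p(1-3)]
      adjoin_subset[OF is_subfield_Reals N(2) x]
    unfolding rat_degree_coprime_def by blast
qed

lemma ext_dim_root_of_unity:
  fixes \<zeta> :: complex
  assumes q: "prime q" and z: "\<zeta> ^ q\<^sup>2 = 1" "\<zeta> ^ q \<noteq> 1"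
  shows "is_subfield (adjoin \<rat> \<zeta>)" "ext_dim \<rat> (adjoin \<rat> \<zeta>) (q * (q - 1))"
proof -
  have q0: "q > 1" using q prime_gt_1_nat by blast
  note QQ = is_subfield_Rats[where 'a = complex]
  define P :: "complex poly" where "P = (\<Sum>j<q. monom 1 (q * j))"
  have "poly P \<zeta> = (\<Sum>j<q. (\<zeta> ^ q) ^ j)" by (simp add: P_def poly_sum poly_monom power_mult)
  moreover have "(\<zeta> ^ q - 1) * (\<Sum>j<q. (\<zeta> ^ q) ^ j) = 0"
    using power_diff_1_eq[of "\<zeta> ^ q" q] z(1) by (simp add: power2_eq_square power_mult)
  ultimately have P0: "poly P \<zeta> = 0" using z(2) by simp
  have PQ: "poly_over \<rat> P"
    unfolding P_def poly_over_def coeff_sum by (auto intro!: Rats_sum)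
  have "degree P \<le> q * (q - 1)"
    unfolding P_def using q0 by (intro degree_sum_le) (auto intro!: order.trans[OF degree_monom_le])
  \<comment> \<open>\<open>P\<close> is the cyclotomic polynomial written out; its value q at 1
    shows that it is nonzero.\<close>
  moreover have "poly P 1 \<noteq> 0" using q0 by (simp add: P_def poly_sum poly_monom)
  then have Pn: "P \<noteq> 0" by auto
  obtain g where g: "min_poly_over \<rat> \<zeta> g" "ext_dim \<rat> (adjoin \<rat> \<zeta>) (degree g)" "degree g \<le> degree P"
    using ex_min_poly_over[OF QQ PQ Pn P0] by blast
  have "q * (q - 1) \<le> degree g"
    using g(1) by (intro degree_ge_of_root_of_unity[OF q z]) (auto simp: min_poly_over_def poly_over_def)
  ultimately have "degree g = q * (q - 1)" using g(3) by linarith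
  then show "ext_dim \<rat> (adjoin \<rat> \<zeta>) (q * (q - 1))" using g(2) by simp
  show "is_subfield (adjoin \<rat> \<zeta>)" by (rule is_subfield_adjoin[OF QQ PQ Pn P0])
qed

text \<open>\<zeta> has degree 1 or 2 over L, so its adjunction keeps the degree over the rationals
  prime to the odd q. But the resulting field contains the rationals with \<zeta> adjoined, of
  degree \<open>q * (q - 1)\<close>.\<close>

lemma rat_degree_coprime_no_root_of_unity:
  fixes \<zeta> c :: complex
  assumes q: "prime q" "odd q" and L: "rat_degree_coprime q L"
    and z: "\<zeta> ^ q\<^sup>2 = 1" "\<zeta> ^ q \<noteq> 1" and c: "c \<in> L" "\<zeta>\<^sup>2 - 2 * c * \<zeta> + 1 = 0"
  shows False
proof -
  obtain N where N: "is_subfield L" "ext_dim \<rat> L N" "\<not> q dvd N"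
    using L by (auto simp: rat_degree_coprime_def)
  have QL: "\<rat> \<subseteq> L" by (rule Rats_subset_subfield[OF N(1)])
  have "2 \<in> L" using QL by auto
  then have p: "poly_over L [:1, - 2 * c, 1:]" 
    using c(1) N(1) by (simp add: poly_over_simps is_subfieldD)
  have p0: "[:1, - 2 * c, 1:] \<noteq> 0" "poly [:1, - 2 * c, 1:] \<zeta> = 0"
    using c(2) by (simp_all add: power2_eq_square algebra_simps)
  obtain g where g: "min_poly_over L \<zeta> g" "ext_dim L (adjoin L \<zeta>) (degree g)" "degree g \<le> 2"
  proof -
    have "degree [:1, - 2 * c, 1:] = 2" by simp
    then show thesis using ex_min_poly_over[OF N(1) p p0] that by metis
  qed
  have q2: "q > 2" using q prime_ge_2_nat[OF q(1)] by (cases "q = 2") auto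
  have "degree g > 0" using g(1) by (simp add: min_poly_over_def)
  then have "\<not> q dvd degree g" using g(3) q2 by (auto dest: dvd_imp_le)
  then have nd: "\<not> q dvd N * degree g" using N(3) q by (simp add: prime_dvd_mult_iff)
  have E: "is_subfield (adjoin L \<zeta>)" by (rule is_subfield_adjoin[OF N(1) p p0])
  have sub: "adjoin \<rat> \<zeta> \<subseteq> adjoin L \<zeta>"
    using adjoin_subset[OF E] QL subset_adjoin[OF N(1)] by blast
  note F = ext_dim_root_of_unity[OF q(1) z]
  obtain a b where ab: "ext_dim \<rat> (adjoin \<rat> \<zeta>) a" "N * degree g = a * b"
    by (rule ext_dim_tower_split[OF is_subfield_Rats F(1) E subset_adjoin(1)[OF is_subfield_Rats] sub
      ext_dim_tower[OF is_subfield_Rats N(1,2) g(2)]])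
  moreover have "a = q * (q - 1)" by (rule ext_dim_unique[OF is_subfield_Rats ab(1) F(2)])
  ultimately show False using nd by auto
qed

section \<open>Casus irreducibilis\<close>

text \<open>All conjugates of \<open>\<alpha>\<close> have absolute value \<open>\<alpha>\<close>, and the field is real, so the norm of \<open>\<alpha>\<close> is its
  degree-th power up to sign.\<close>

lemma norm_min_poly_of_radical:
  fixes \<alpha> :: real
  assumes K: "is_subfield K" "K \<subseteq> \<real>" and a: "\<alpha> > 0" "k > 0" "of_real (\<alpha> ^ k) \<in> K"
    and g: "min_poly_over K (of_real \<alpha> :: complex) g"
  shows "of_real (\<alpha> ^ degree g) \<in> K"
proof -
  have g': "poly_over K g" "lead_coeff g = 1" using g by (auto simp: min_poly_over_def)
  define h :: "complex poly" where "h = monom 1 k - [:of_real (\<alpha> ^ k):]"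
  have "g dvd h"
    using a K(1) unfolding h_def
    by (intro min_poly_over_dvd[OF K(1) g]) (auto simp: poly_over_simps is_subfieldD poly_monom)
  have "g \<noteq> 0" using g'(2) by auto
  then obtain A where A: "size A = degree g" "g = (\<Prod>x\<in>#A. [:-x, 1:])"
    using alg_closed_imp_factorization[of g] g'(2) by auto
  \<comment> \<open>Roots of g are roots of \<open>h\<close>, so their k-th power is
    \<open>\<alpha> ^ k\<close>; taking norms loses the root of unity by which they may differ from
    \<alpha>.\<close>
  have nrm: "norm z = \<alpha>" if "z \<in># A" for z
  proof -
    have "[:-z, 1:] dvd g" unfolding A(2) using that by (intro dvd_prod_mset) auto
    then have "[:-z, 1:] dvd h" using \<open>g dvd h\<close> by (rule dvd_trans)
    then have "poly h z = 0" by (simp add: poly_eq_0_iff_dvd)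
    then have "z ^ k = of_real (\<alpha> ^ k)" by (simp add: h_def poly_monom)
    then have "norm z ^ k = \<alpha> ^ k" using a(1) by (metis norm_power norm_of_real abs_of_pos zero_less_power)
    then show ?thesis using power_eq_imp_eq_base[of "norm z" k \<alpha>] a by simp
  qed
  have "norm (poly (\<Prod>x\<in>#B. [:-x, 1:]) 0) = \<alpha> ^ size B" if "\<And>z. z \<in># B \<Longrightarrow> norm z = \<alpha>" for B :: "complex multiset"
    using that by (induction B) (auto simp: norm_mult)
  from this[OF nrm] have "norm (poly g 0) = \<alpha> ^ degree g" using A by simp
  then have "norm (coeff g 0) = \<alpha> ^ degree g" by (simp add: poly_0_coeff_0)
  moreover have g0: "coeff g 0 \<in> K" using g' by (simp add: poly_over_def)
  \<comment> \<open>Being real, the constant coefficient equals its absolute value up to sign; this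
    puts the power of \<alpha> itself into K.\<close>
  then obtain r where r: "coeff g 0 = of_real r" using K(2) by (auto elim: Reals_cases)
  ultimately have "\<alpha> ^ degree g = r \<or> \<alpha> ^ degree g = - r" by (auto simp: abs_if split: if_splits)
  then show ?thesis using g0 r is_subfieldD(5)[OF K(1) g0] by (metis of_real_minus)
qed

text \<open>The triple angle formula: for x = 2 cos t, \<open>x ^ 3 - 3 * x\<close> is 2 cos 3t,
  which equals -1 at t = 2 pi / 9.\<close>

definition trisection_poly :: "complex poly" where
  "trisection_poly = [:1, -3, 0, 1:]"

text \<open>The invariant of the radical model. Reality belongs to it because it makes cube roots
  unique and norms known up to sign.\<close>

definition no_trisection_root :: "complex set \<Rightarrow> bool" where
  "no_trisection_root L \<longleftrightarrow> is_subfield L \<and> L \<subseteq> \<real> \<and> (\<forall>x\<in>L. poly trisection_poly x \<noteq> 0)"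

lemma poly_trisection: "poly trisection_poly x = x ^ 3 - 3 * x + 1"
  by (simp add: trisection_poly_def power3_eq_cube algebra_simps)

lemma poly_over_trisection: "is_subfield K \<Longrightarrow> poly_over K trisection_poly"
proof -
  assume K: "is_subfield K"
  then have "-3 \<in> K" using Rats_subset_subfield[OF K] by auto
  then show ?thesis unfolding trisection_poly_def using K by (simp add: poly_over_simps is_subfieldD)
qed

text \<open>For a root a / b in lowest terms the integer
  \<open>a ^ 3 - 3 * a * b\<^sup>2 + b ^ 3\<close> vanishes, but it is odd unless a and b are both
  even.\<close>

lemma no_trisection_root_Rats: "no_trisection_root \<rat>"
proof -
  have "x ^ 3 - 3 * x + 1 \<noteq> 0" if xQ: "x \<in> \<rat>" for x :: complex
  proof
    assume x: "x ^ 3 - 3 * x + 1 = 0"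
    obtain a b :: int where ab: "b > 0" "coprime a b" "x = of_int a / of_int b"
      using xQ by (metis Rats_cases')
    have "(of_int (a ^ 3 - 3 * a * b\<^sup>2 + b ^ 3) :: complex) = 0"
    proof -
      have "of_int a = x * of_int b" using ab(1) by (simp add: ab(3))
      then have "(of_int (a ^ 3 - 3 * a * b\<^sup>2 + b ^ 3) :: complex) = of_int b ^ 3 * (x ^ 3 - 3 * x + 1)"
        by (simp add: power2_eq_square power3_eq_cube algebra_simps)
      then show ?thesis using x by simp
    qed
    then have "a ^ 3 - 3 * a * b\<^sup>2 + b ^ 3 = 0" by (simp only: of_int_eq_0_iff)
    then have "even (a ^ 3 - 3 * a * b\<^sup>2 + b ^ 3)" by simp
    then have "even a \<and> even b" by auto
    then show False using ab(2) by auto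
  qed
  then show ?thesis
    using is_subfield_Rats Rats_subset_subfield[OF is_subfield_Reals]
    by (auto simp: no_trisection_root_def poly_trisection)
qed

text \<open>A cubic without a root in L is irreducible, so \<beta> has degree 3. The proof is
  explicit: a linear relation would put \<beta> into L, a quadratic one would put the third root
  into L.\<close>

lemma trisection_root_independent:
  assumes L: "is_subfield L" "\<forall>x\<in>L. poly trisection_poly x \<noteq> 0" and b: "poly trisection_poly \<beta> = 0"
    and uvw: "u \<in> L" "v \<in> L" "w \<in> L" "u + v * \<beta> + w * \<beta>\<^sup>2 = 0"
  shows "u = 0 \<and> v = 0 \<and> w = 0"
proof -
  note D = is_subfieldD[OF L(1)]
  have bL: "\<beta> \<notin> L" using L(2) b by blast
  have lin: "u = 0 \<and> v = 0" if "u \<in> L" "v \<in> L" "u + v * \<beta> = 0" for u v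
  proof (cases "v = 0")
    case False
    then have "\<beta> = - (u / v)" using that(3) by (simp add: field_simps eq_neg_iff_add_eq_0)
    then show ?thesis using bL D(5)[OF D(8)] that by blast
  qed (use that in auto)
  have "w = 0"
  proof (rule ccontr)
    assume w: "w \<noteq> 0"
    define s t where "s = - (v / w)" and "t = - (u / w)"
    have st: "s \<in> L" "t \<in> L" using uvw D(5,8) by (auto simp: s_def t_def)
    have b2: "\<beta>\<^sup>2 = s * \<beta> + t"
    proof -
      have "w * \<beta>\<^sup>2 = - (u + v * \<beta>)"
        unfolding eq_neg_iff_add_eq_0 using uvw(4) by (simp add: add.commute)
      moreover have "w * s = - v" "w * t = - u" using w by (simp_all add: s_def t_def)
      ultimately have "w * (s * \<beta> + t) = w * \<beta>\<^sup>2"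
        by (simp add: distrib_left mult.assoc[symmetric])
      then show ?thesis using w by simp
    qed
    have "(3::complex) \<in> L" using Rats_subset_subfield[OF L(1)] by auto
    have "\<beta> ^ 3 = \<beta> * \<beta>\<^sup>2" by (simp add: power3_eq_cube power2_eq_square)
    also have "\<dots> = s * \<beta>\<^sup>2 + t * \<beta>" by (subst b2) (simp add: power2_eq_square algebra_simps)
    also have "\<dots> = (s\<^sup>2 + t) * \<beta> + s * t" unfolding b2 by (simp add: power2_eq_square algebra_simps)
    finally have "(s * t + 1) + (s\<^sup>2 + t - 3) * \<beta> = 0"
      using b by (simp add: poly_trisection algebra_simps)
    then have z: "s * t + 1 = 0" "s\<^sup>2 + t - 3 = 0"
      using lin[of "s * t + 1" "s\<^sup>2 + t - 3"] st D \<open>3 \<in> L\<close> by auto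
    have t: "t = 3 - s\<^sup>2" using z(2) by (simp add: algebra_simps)
    \<comment> \<open>The three roots sum to 0 because the cubic has no quadratic term; the two
      roots of \<open>x\<^sup>2 - s * x - t\<close> sum to s, which leaves
      \<open>- s\<close>.\<close>
    have "poly trisection_poly (- s) = 0"
      using z(1) unfolding poly_trisection t by (simp add: power2_eq_square power3_eq_cube algebra_simps)
    then show False using L(2) D(5) st by blast
  qed
  then show ?thesis using lin[of u v] uvw by auto
qed

text \<open>In the complex plane a cube fixes its root only up to a third root of unity; reality
  removes this ambiguity, which is the crux of the cubic case.\<close>

lemma real_cube_inj: "x \<in> \<real> \<Longrightarrow> y \<in> \<real> \<Longrightarrow> x ^ 3 = y ^ 3 \<Longrightarrow> x = (y :: complex)"
proof (elim Reals_cases)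
  fix a b assume "x ^ 3 = y ^ 3" "x = of_real a" "y = of_real b"
  then have "a ^ 3 = b ^ 3" by (metis of_real_eq_iff of_real_power)
  moreover have "root 3 (a ^ 3) = a" "root 3 (b ^ 3) = b"
    by (rule odd_real_root_power_cancel, simp)+
  ultimately have "a = b" by metis
  then show "x = y" by (simp add: \<open>x = of_real a\<close> \<open>y = of_real b\<close>)
qed

lemma poly_degree_less_3:
  assumes "degree p < 3"
  shows "p = [:coeff p 0, coeff p 1, coeff p 2:]"
proof (rule poly_eqI)
  fix n show "coeff p n = coeff [:coeff p 0, coeff p 1, coeff p 2:] n"
    using coeff_eq_0[of p n] assms by (auto simp: coeff_pCons numeral_2_eq_2 split: nat.splits)
qed

text \<open>The Galois group of the trisection polynomial is generated by \<open>\<beta> \<mapsto> \<beta>\<^sup>2 - 2\<close>, under which a real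
  cube root of a base element is fixed.\<close>

lemma trisection_field_no_cube_root:
  assumes L: "no_trisection_root L" and b: "poly trisection_poly \<beta> = 0" "\<beta> \<in> \<real>"
    and c: "\<gamma> \<in> adjoin L \<beta>" "\<gamma> ^ 3 \<in> L"
  shows "\<gamma> \<in> L"
proof -
  have L': "is_subfield L" "\<forall>x\<in>L. poly trisection_poly x \<noteq> 0" "L \<subseteq> \<real>"
    using L by (auto simp: no_trisection_root_def)
  note D = is_subfieldD[OF L'(1)] and ind = trisection_root_independent[OF L'(1,2) b(1)]
  have tri: "poly_over L trisection_poly" "lead_coeff trisection_poly = 1" "degree trisection_poly > 0"
    "degree trisection_poly = 3"
    using poly_over_trisection[OF L'(1)] by (auto simp: trisection_poly_def)
  have rem: "\<exists>q u v w. h = q * trisection_poly + [:u, v, w:] \<and> u \<in> L \<and> v \<in> L \<and> w \<in> L" if h: "poly_over L h" for h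
  proof -
    obtain q r where qr: "h = q * trisection_poly + r" "poly_over L r" "degree r < 3"
      using poly_over_division[OF L'(1) tri(1-3) h] unfolding tri(4) by metis
    have "r = [:coeff r 0, coeff r 1, coeff r 2:]" by (rule poly_degree_less_3[OF qr(3)])
    then show ?thesis using qr(1,2) unfolding poly_over_def by metis
  qed
  \<comment> \<open>For \<beta> = 2 cos t this is 2 cos 2t: doubling the angle permutes the
    roots.\<close>
  define \<beta>' where "\<beta>' = \<beta>\<^sup>2 - 2"
  have b3: "\<beta> ^ 3 = 3 * \<beta> - 1" using b(1) by (simp add: poly_trisection algebra_simps)
  have "poly trisection_poly \<beta>' = (\<beta> ^ 3 - 3 * \<beta>)\<^sup>2 - 1"
    unfolding poly_trisection \<beta>'_def
    by (simp add: power2_eq_square power3_eq_cube algebra_simps)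
  then have b': "poly trisection_poly \<beta>' = 0" by (simp add: b3)
  obtain h where h: "poly_over L h" "\<gamma> = poly h \<beta>" using c(1) by (auto simp: adjoin_def)
  obtain q u v w where quvw: "h = q * trisection_poly + [:u, v, w:]" "u \<in> L" "v \<in> L" "w \<in> L"
    using rem[OF h(1)] by blast
  define r where "r = [:u, v, w:]"
  have rL: "poly_over L r" using quvw by (simp add: r_def poly_over_simps[OF L'(1)])
  have g: "\<gamma> = poly r \<beta>" using b(1) by (simp add: h(2) quvw(1) r_def)
  \<comment> \<open>Replaces the application of an automorphism: \<open>H\<close> has coefficients
    in L and vanishes at \<beta>, so by independence its remainder modulo the cubic is 0, and it
    vanishes at \<beta>' too.\<close>
  define H where "H = r * r * r - [:\<gamma> ^ 3:]"
  have H: "poly H x = poly r x ^ 3 - \<gamma> ^ 3" for x by (simp add: H_def power3_eq_cube)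
  have "poly_over L H"
    unfolding H_def using rL c(2) by (simp add: poly_over_simps[OF L'(1)])
  then obtain q' u' v' w' where q': "H = q' * trisection_poly + [:u', v', w':]" "u' \<in> L" "v' \<in> L" "w' \<in> L"
    using rem by blast
  have "poly H \<beta> = 0" by (simp add: H g)
  then have "u' + v' * \<beta> + w' * \<beta>\<^sup>2 = 0" using b(1) by (simp add: q'(1) power2_eq_square algebra_simps)
  then have "u' = 0 \<and> v' = 0 \<and> w' = 0" using ind q' by blast
  then have "poly H \<beta>' = 0" using b' by (simp add: q'(1))
  then have "poly r \<beta>' ^ 3 = poly r \<beta> ^ 3" by (simp add: H g)
  moreover have "\<beta>' \<in> \<real>" using b(2) by (simp add: \<beta>'_def)
  then have "poly r \<beta>' \<in> \<real>" "poly r \<beta> \<in> \<real>" 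
    using poly_in_subfield[OF is_subfield_Reals, of r] b(2) rL L'(3) by (auto simp: poly_over_def)
  ultimately have "poly r \<beta>' = poly r \<beta>"
    using real_cube_inj by blast
  \<comment> \<open>The difference of the values of \<open>u + v x + w x\<^sup>2\<close> at \<beta>'
    and \<beta>, factored. Independence then forces w = 0 and v = 0, so \<gamma> is u.\<close>
  then have "(\<beta>' - \<beta>) * (v + w * (\<beta> + \<beta>')) = 0" by (simp add: r_def algebra_simps)
  moreover have "\<beta>' - \<beta> \<noteq> 0"
  proof
    assume "\<beta>' - \<beta> = 0"
    then have "(-2) + (-1) * \<beta> + 1 * \<beta>\<^sup>2 = 0" by (simp add: \<beta>'_def algebra_simps)
    moreover have "(-2 :: complex) \<in> L" using Rats_subset_subfield[OF L'(1)] by auto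
    ultimately show False using ind[of "-2" "-1" 1] D(1,5) by auto
  qed
  ultimately have "v + w * (\<beta> + \<beta>') = 0" by (metis mult_eq_0_iff)
  then have z: "(v - 2 * w) + w * \<beta> + w * \<beta>\<^sup>2 = 0" by (simp add: \<beta>'_def algebra_simps)
  have "(2 :: complex) \<in> L" using Rats_subset_subfield[OF L'(1)] by auto
  then have "v - 2 * w \<in> L" by (rule D(3)[OF quvw(3) D(6)[OF _ quvw(4)]])
  then have "v - 2 * w = 0 \<and> w = 0" using ind[OF _ quvw(4) quvw(4) z] by simp
  then show ?thesis using g quvw by (simp add: r_def)
qed

text \<open>Suppose a root \<beta> appears in L(\<alpha>). Then L(\<beta>) has degree 3 over L, so
  \<alpha> has degree 3e over L and degree e over L(\<beta>). Norms put
  \<open>\<alpha> ^ (3 * e)\<close> into L and \<open>\<alpha> ^ e\<close> into L(\<beta>), so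
  \<open>\<alpha> ^ e\<close> is a real cube root of an element of L and must lie in L. This bounds
  the degree of \<alpha> over L by e.\<close>

lemma no_trisection_root_adjoin_radical:
  fixes \<alpha> :: real
  assumes L: "no_trisection_root L" and a: "\<alpha> > 0" "k > 0" "of_real (\<alpha> ^ k) \<in> L"
  shows "no_trisection_root (adjoin L (of_real \<alpha>))"
proof -
  have L': "is_subfield L" "\<forall>x\<in>L. poly trisection_poly x \<noteq> 0" "L \<subseteq> \<real>"
    using L by (auto simp: no_trisection_root_def)
  note D = is_subfieldD[OF L'(1)]
  let ?\<alpha> = "of_real \<alpha> :: complex"
  have rad: "\<exists>h. poly_over K h \<and> h \<noteq> 0 \<and> poly h ?\<alpha> = 0 \<and> degree h = k" 
    if "is_subfield K" "of_real (\<alpha> ^ k) \<in> K" "k > 0" for K k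
  proof (intro exI conjI)
    let ?h = "monom 1 k - [:of_real (\<alpha> ^ k):] :: complex poly"
    show "poly_over K ?h" using that by (auto simp: poly_over_simps is_subfieldD)
    show "poly ?h ?\<alpha> = 0" by (simp add: poly_monom)
    have "degree ?h = degree (monom 1 k + [:- of_real (\<alpha> ^ k):] :: complex poly)"
      by (simp only: diff_conv_add_uminus minus_pCons minus_zero)
    also have "\<dots> = degree (monom 1 k :: complex poly)"
      by (rule degree_add_eq_left) (use that(3) in \<open>simp add: degree_monom_eq\<close>)
    finally show "degree ?h = k" by (simp add: degree_monom_eq)
    then show "?h \<noteq> 0" using that(3) by auto
  qed
  obtain h where h: "poly_over L h" "h \<noteq> 0" "poly h ?\<alpha> = 0" using rad[OF L'(1) a(3,2)] by blast
  obtain g where g: "min_poly_over L ?\<alpha> g" "ext_dim L (adjoin L ?\<alpha>) (degree g)"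
    using ex_min_poly_over[OF L'(1) h] by blast
  have E: "is_subfield (adjoin L ?\<alpha>)" by (rule is_subfield_adjoin[OF L'(1) h])
  have ER: "adjoin L ?\<alpha> \<subseteq> \<real>" by (rule adjoin_subset[OF is_subfield_Reals L'(3)]) simp
  have "poly trisection_poly \<beta> \<noteq> 0" if bE: "\<beta> \<in> adjoin L ?\<alpha>" for \<beta>
  proof
    assume b: "poly trisection_poly \<beta> = 0"
    have bR: "\<beta> \<in> \<real>" using bE ER by blast
    have tri: "poly_over L trisection_poly" "trisection_poly \<noteq> 0" "degree trisection_poly = 3"
      using poly_over_trisection[OF L'(1)] by (auto simp: trisection_poly_def)
    obtain f where f: "min_poly_over L \<beta> f" "ext_dim L (adjoin L \<beta>) (degree f)" "degree f \<le> 3"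
      using ex_min_poly_over[OF L'(1) tri(1,2) b] tri(3) by metis
    let ?F = "adjoin L \<beta>"
    have F: "is_subfield ?F" by (rule is_subfield_adjoin[OF L'(1) tri(1,2) b])
    have LF: "L \<subseteq> ?F" "\<beta> \<in> ?F" by (rule subset_adjoin[OF L'(1)])+
    have FE: "?F \<subseteq> adjoin L ?\<alpha>" by (rule adjoin_subset[OF E subset_adjoin(1)[OF L'(1)] bE])
    have FR: "?F \<subseteq> \<real>" using FE ER by blast
    have f': "poly_over L f" "lead_coeff f = 1" "poly f \<beta> = 0" using f(1) by (auto simp: min_poly_over_def)
    have "degree f = 3"
    proof (rule ccontr)
      assume "degree f \<noteq> 3"
      then have lt: "degree f < 3" using f(3) by simp
      have "coeff f 0 + coeff f 1 * \<beta> + coeff f 2 * \<beta>\<^sup>2 = 0"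
        using f'(3) by (subst (asm) poly_degree_less_3[OF lt]) (simp add: power2_eq_square algebra_simps)
      then have "coeff f 0 = 0 \<and> coeff f 1 = 0 \<and> coeff f 2 = 0"
        using trisection_root_independent[OF L'(1,2) b] f'(1) unfolding poly_over_def by blast
      moreover have "degree f = 0 \<or> degree f = 1 \<or> degree f = 2" using lt by linarith
      ultimately show False using f'(2) by auto
    qed
    then obtain e where e: "ext_dim ?F (adjoin L ?\<alpha>) e" "degree g = 3 * e"
      using ext_dim_tower_split[OF L'(1) F E LF(1) FE g(2)] ext_dim_unique[OF L'(1) _ f(2)] by metis
    have gpos: "degree g > 0" using g(1) by (simp add: min_poly_over_def)
    have akF: "of_real (\<alpha> ^ k) \<in> ?F" using a(3) LF by blast
    obtain h' where h': "poly_over ?F h'" "h' \<noteq> 0" "poly h' ?\<alpha> = 0" using rad[OF F akF a(2)] by blast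
    obtain g' where g': "min_poly_over ?F ?\<alpha> g'" "ext_dim ?F (adjoin ?F ?\<alpha>) (degree g')"
      using ex_min_poly_over[OF F h'] by blast
    have E': "is_subfield (adjoin ?F ?\<alpha>)" by (rule is_subfield_adjoin[OF F h'])
    \<comment> \<open>\<beta> already lies in L(\<alpha>), so adjoining \<alpha> to L(\<beta>) gives
      nothing larger; hence the degree of \<alpha> over L(\<beta>) is the upper factor e.\<close>
    have "adjoin ?F ?\<alpha> = adjoin L ?\<alpha>"
      using adjoin_subset[OF E FE subset_adjoin(2)[OF L'(1)]]
        adjoin_subset[OF E' _ subset_adjoin(2)[OF F], of L] LF(1) subset_adjoin(1)[OF F, of ?\<alpha>] by blast
    then have "degree g' = e" using g'(2) e(1) ext_dim_unique[OF F] by simp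
    then have "of_real (\<alpha> ^ e) \<in> ?F" using norm_min_poly_of_radical[OF F FR a(1,2) akF g'(1)] by simp
    moreover have "of_real (\<alpha> ^ (3 * e)) \<in> L"
      using norm_min_poly_of_radical[OF L'(1,3) a g(1)] e(2) by simp
    then have "(of_real (\<alpha> ^ e) :: complex) ^ 3 \<in> L" by (simp add: mult.commute power_mult)
    ultimately have "of_real (\<alpha> ^ e) \<in> L"
      by (rule trisection_field_no_cube_root[OF L b bR])
    then obtain h2 where "poly_over L h2" "h2 \<noteq> 0" "poly h2 ?\<alpha> = 0" "degree h2 = e"
      using rad[OF L'(1), of e] gpos e(2) by auto
    then have "degree g \<le> e" using g(1) unfolding min_poly_over_def by blast
    then show False using gpos e(2) by simp
  qed
  then show ?thesis using E ER by (simp add: no_trisection_root_def)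
qed

section \<open>The regular bipyramid\<close>

lemma convex_comb3_zero:
  assumes "convex P" "0 \<in> P" "a \<in> P" "b \<in> P" "c \<in> P"
    and "x \<ge> 0" "y \<ge> 0" "z \<ge> 0" "x + y + z \<le> (1::real)"
  shows "x *\<^sub>R a + y *\<^sub>R b + z *\<^sub>R c \<in> P"
proof -
  have "(\<Sum>i\<in>{0,1,2,3::nat}. ([x, y, z, 1 - x - y - z] ! i) *\<^sub>R ([a, b, c, 0] ! i)) \<in> P"
    by (rule convex_sum) (use assms in auto)
  then show ?thesis by (simp add: add.assoc)
qed

text \<open>A face of the hull of a finite set is the hull of some of its generators, and those
  generators all lie on the supporting hyperplane.\<close>

lemma convex_hull_Int_supporting_hyperplane:
  fixes V :: "'a::euclidean_space set"
  assumes "finite V" "\<And>v. v \<in> V \<Longrightarrow> a \<bullet> v \<le> b"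
  shows "convex hull V \<inter> {x. a \<bullet> x = b} = convex hull {v \<in> V. a \<bullet> v = b}"
    and "convex hull {v \<in> V. a \<bullet> v = b} face_of convex hull V"
proof -
  have le: "a \<bullet> x \<le> b" if "x \<in> convex hull V" for x
    using hull_minimal[of V "{x. a \<bullet> x \<le> b}" convex] assms(2) that
    by (auto simp: convex_halfspace_le)
  then have face: "convex hull V \<inter> {x. a \<bullet> x = b} face_of convex hull V"
    by (intro face_of_Int_supporting_hyperplane_le) auto
  then obtain W where W: "W \<subseteq> V" "convex hull V \<inter> {x. a \<bullet> x = b} = convex hull W"
    using face_of_convex_hull_subset[OF finite_imp_compact[OF assms(1)]] by blast
  have "W \<subseteq> {v \<in> V. a \<bullet> v = b}" using W hull_subset[of W convex] by blast
  then have 1: "convex hull W \<subseteq> convex hull {v \<in> V. a \<bullet> v = b}" by (rule hull_mono)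
  have "{v \<in> V. a \<bullet> v = b} \<subseteq> convex hull V \<inter> {x. a \<bullet> x = b}"
    using hull_subset[of V convex] by auto
  then have "convex hull {v \<in> V. a \<bullet> v = b} \<subseteq> convex hull W"
    unfolding W(2) by (rule hull_minimal) simp
  with 1 W show "convex hull V \<inter> {x. a \<bullet> x = b} = convex hull {v \<in> V. a \<bullet> v = b}" by auto
  with face show "convex hull {v \<in> V. a \<bullet> v = b} face_of convex hull V" by simp
qed

text \<open>The strict inequalities cut out an open set around 0 inside P. A relative interior point
  of a facet avoids it, so some inequality is tight there; the whole facet then lies in the
  corresponding face and equals it by dimension.\<close>

lemma facets_of_convex_hull:
  fixes V :: "'a::euclidean_space set" and a :: "'i \<Rightarrow> 'a"
  defines "P \<equiv> convex hull V" and "T \<equiv> \<lambda>i. {v \<in> V. a i \<bullet> v = 1}"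
  assumes fin: "finite V" "finite I"
    and le: "\<And>i v. i \<in> I \<Longrightarrow> v \<in> V \<Longrightarrow> a i \<bullet> v \<le> 1"
    and dim: "\<And>i. i \<in> I \<Longrightarrow> aff_dim (T i) = int DIM('a) - 1"
    and cover: "\<And>x. (\<And>i. i \<in> I \<Longrightarrow> a i \<bullet> x < 1) \<Longrightarrow> x \<in> P"
  shows "aff_dim P = int DIM('a)" and "{F. F facet_of P} = (\<lambda>i. convex hull T i) ` I"
proof -
  define U where "U = (\<Inter>i\<in>I. {x. a i \<bullet> x < 1})"
  have U: "open U" "U \<subseteq> P"
    using cover fin by (auto simp: U_def intro!: open_INT open_halfspace_lt)
  then have int: "U \<subseteq> interior P" by (rule interior_maximal[rotated])
  have "0 \<in> U" by (auto simp: U_def)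
  then have "interior P \<noteq> {}" using int by auto
  then show dimP: "aff_dim P = int DIM('a)"
    by (rule aff_dim_nonempty_interior)
  have face: "P \<inter> {x. a i \<bullet> x = 1} = convex hull T i" "convex hull T i face_of P" if "i \<in> I" for i
    using convex_hull_Int_supporting_hyperplane[of V "a i" 1] fin le that by (auto simp: P_def T_def)
  have leP: "a i \<bullet> x \<le> 1" if "x \<in> P" "i \<in> I" for x i
    using hull_minimal[of V "{x. a i \<bullet> x \<le> 1}" convex] le that
    by (auto simp: convex_halfspace_le P_def)
  have facet: "convex hull T i facet_of P" if "i \<in> I" for i
  proof -
    have "aff_dim (convex hull T i) \<noteq> -1" using dim[OF that] DIM_positive[where 'a='a]
      by (simp add: aff_dim_convex_hull)
    then have "convex hull T i \<noteq> {}" by force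
    then show ?thesis
      using face(2)[OF that] dim[OF that] dimP by (simp add: facet_of_def aff_dim_convex_hull)
  qed
  have "F \<in> (\<lambda>i. convex hull T i) ` I" if F: "F facet_of P" for F
  proof -
    have Ff: "F face_of P" "F \<noteq> {}" "aff_dim F = int DIM('a) - 1"
      using F dimP by (auto simp: facet_of_def)
    have cF: "convex F" using Ff(1) face_of_imp_convex by blast
    then obtain x where x: "x \<in> rel_interior F" using Ff(2) rel_interior_eq_empty by blast
    then have xF: "x \<in> F" using rel_interior_subset by blast
    have "F \<noteq> P" using Ff(3) dimP by auto
    then have "x \<notin> U" using face_of_disjoint_interior[OF Ff(1)] xF int by blast
    then obtain i where i: "i \<in> I" "\<not> a i \<bullet> x < 1" by (auto simp: U_def)
    have xP: "x \<in> P" using xF face_of_imp_subset[OF Ff(1)] by blast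
    then have "x \<in> convex hull T i" using leP[OF _ i(1)] i face(1)[OF i(1)] by force
    then have sub: "F \<subseteq> convex hull T i"
      using subset_of_face_of[OF face(2)[OF i(1)] face_of_imp_subset[OF Ff(1)]] x by blast
    then have "F face_of convex hull T i"
      using face_of_face[OF face(2)[OF i(1)]] Ff(1) by blast
    then have "F = convex hull T i"
      using face_of_aff_dim_lt[of "convex hull T i" F] Ff(3) dim[OF i(1)]
      by (auto simp: aff_dim_convex_hull)
    then show ?thesis using i(1) by blast
  qed
  then show "{F. F facet_of P} = (\<lambda>i. convex hull T i) ` I" using facet by auto
qed

lemma cos_less_cos_between:
  assumes "0 \<le> d" "d < t" "t < 2 * pi - d"
  shows "cos t < cos d"
proof (cases "t \<le> pi")
  case True
  then show ?thesis using assms by (intro cos_monotone_0_pi) auto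
next
  case False
  have "cos t = cos (2 * pi - t)" by (simp add: cos_diff)
  also have "\<dots> < cos d" using assms False by (intro cos_monotone_0_pi) auto
  finally show ?thesis .
qed

locale regular_bipyramid =
  fixes n :: nat and r h :: real
  assumes n: "n \<ge> 3" and r: "r > 0" and h: "h > 0"
begin

definition \<delta> :: real where "\<delta> = 2 * pi / n"

definition vtx :: "nat \<Rightarrow> real^3" where
  "vtx i = vector [r * cos (i * \<delta>), r * sin (i * \<delta>), 0]"

definition pole :: "real \<Rightarrow> real^3" where
  "pole e = vector [0, 0, e * h]"

text \<open>Facet planes scaled to right-hand side 1. The horizontal part points at the midpoint of
  edge i, at distance \<open>r * cos (\<delta> / 2)\<close> from the axis; e = 1 or -1 selects the
  pole, so that \<open>e / h\<close> is the inverse of its height.\<close>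

definition nrml :: "nat \<times> real \<Rightarrow> real^3" where
  "nrml = (\<lambda>(i, e). vector [cos ((i + 1/2) * \<delta>) / (r * cos (\<delta> / 2)),
     sin ((i + 1/2) * \<delta>) / (r * cos (\<delta> / 2)), e / h])"

lemma delta: "0 < \<delta>" "\<delta> < pi" "n * \<delta> = 2 * pi" "cos (\<delta> / 2) > 0" "sin \<delta> > 0"
proof -
  show d: "0 < \<delta>" "\<delta> < pi" "n * \<delta> = 2 * pi"
    using n by (auto simp: \<delta>_def field_simps)
  show "cos (\<delta> / 2) > 0" using d by (intro cos_gt_zero_pi) auto
  show "sin \<delta> > 0" using d by (intro sin_gt_zero) auto
qed

lemma vtx_mod: "i < n \<Longrightarrow> vtx (Suc i mod n) = vtx (Suc i)"
proof (cases "Suc i = n")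
  case True
  have "vtx n = vtx 0" using delta(3) by (simp add: vtx_def)
  then show ?thesis using True by simp
qed simp

lemma nrml_vtx: "nrml (i, e) \<bullet> vtx j = cos ((real j - real i - 1/2) * \<delta>) / cos (\<delta> / 2)"
proof -
  have "nrml (i, e) \<bullet> vtx j =
    (cos ((i + 1/2) * \<delta>) * cos (j * \<delta>) + sin ((i + 1/2) * \<delta>) * sin (j * \<delta>)) / cos (\<delta> / 2)"
    using r delta(4) by (simp add: nrml_def vtx_def inner_vec_def sum_3 field_simps)
  also have "\<dots> = cos (j * \<delta> - (i + 1/2) * \<delta>) / cos (\<delta> / 2)"
    by (simp add: cos_diff algebra_simps)
  finally show ?thesis by (simp add: algebra_simps)
qed

lemma nrml_pole: "nrml (i, e) \<bullet> pole e' = e * e'"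
  using h by (simp add: nrml_def pole_def inner_vec_def sum_3)

text \<open>Measured in units of \<delta>, the angle k from the midpoint of edge i to vertex j is
  1/2 or n - 1/2 exactly at the two ends of the edge. Strictly between these values the cosine is
  smaller.\<close>

lemma nrml_vtx_less:
  assumes "i < n" "j < n" "j \<noteq> i" "j \<noteq> Suc i mod n"
  shows "nrml (i, e) \<bullet> vtx j < 1"
proof -
  define k where "k = \<bar>real j - real i - 1/2\<bar>"
  have "1 < k + 1/2 \<and> k + 1/2 < n"
  proof (cases "j > i")
    case True
    then have "j > Suc i" using assms by (cases "j = Suc i") auto
    then show ?thesis using assms by (auto simp: k_def)
  next
    case False
    then have "real i \<ge> real j + 1" using assms by linarith
    moreover have "i - j < n - 1"
    proof (rule ccontr)
      assume "\<not> i - j < n - 1"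
      then have "j = 0" "Suc i = n" using assms by linarith+
      then show False using assms by simp
    qed
    then have "real i - real j < real n - 1" using False assms by linarith
    ultimately show ?thesis by (auto simp: k_def abs_if)
  qed
  then have k: "1/2 < k" "k < n - 1/2" by auto
  have "\<delta> / 2 < k * \<delta>" using mult_strict_right_mono[OF k(1) delta(1)] by simp
  moreover have "k * \<delta> < 2 * pi - \<delta> / 2"
    using mult_strict_right_mono[OF k(2) delta(1)] delta(3) by (simp add: algebra_simps)
  ultimately have "cos (k * \<delta>) < cos (\<delta> / 2)"
    using delta(1) by (intro cos_less_cos_between) auto
  moreover have "cos (k * \<delta>) = cos ((real j - real i - 1/2) * \<delta>)"
    using delta(1) unfolding k_def by (metis abs_mult abs_of_pos cos_abs_real)
  ultimately show ?thesis using delta(4) by (simp add: nrml_vtx)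
qed

lemma nrml_vtx_eq: "nrml (i, e) \<bullet> vtx i = 1" "nrml (i, e) \<bullet> vtx (Suc i) = 1"
  using delta(4) by (simp_all add: nrml_vtx)

text \<open>Coinciding vertices satisfy the same facet equations, so each would have to be the
  cyclic successor of the other, impossible for n at least 3.\<close>

lemma inj_vtx: "inj_on vtx {..<n}"
proof (rule inj_onI, rule ccontr)
  fix i j assume ij: "i \<in> {..<n}" "j \<in> {..<n}" "vtx i = vtx j" "i \<noteq> j"
  have *: "b = Suc a mod n" if "a < n" "b < n" "vtx a = vtx b" "a \<noteq> b" for a b
  proof (rule ccontr)
    assume "b \<noteq> Suc a mod n"
    then have "nrml (a, 1) \<bullet> vtx b < 1" using nrml_vtx_less[of a b 1] that by simp
    then show False using nrml_vtx_eq(1)[of a 1] that(3) by simp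
  qed
  have j: "j = Suc i mod n" using *[of i j] ij by simp
  have i: "i = Suc j mod n" using *[of j i] ij by simp
  show False
  proof (cases "Suc i = n")
    case True
    then have "j = 0" using j by simp
    then have "i = 1" using i n by simp
    then show False using True n by simp
  next
    case False
    then have "j = Suc i" using j ij(1) by simp
    moreover from this have "Suc j = n" using i ij(2) by (cases "Suc j = n") auto
    ultimately show False using i n by simp
  qed
qed

lemma sector:
  fixes x :: "real^3"
  obtains i \<alpha> \<beta> where "i < n" "\<alpha> \<ge> 0" "\<beta> \<ge> 0"
    "x $ 1 = (\<alpha> *\<^sub>R vtx i + \<beta> *\<^sub>R vtx (Suc i)) $ 1" "x $ 2 = (\<alpha> *\<^sub>R vtx i + \<beta> *\<^sub>R vtx (Suc i)) $ 2"
proof -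
  obtain \<rho> \<phi> where p: "\<rho> \<ge> 0" "0 \<le> \<phi>" "\<phi> < 2 * pi" "x $ 1 = \<rho> * cos \<phi>" "x $ 2 = \<rho> * sin \<phi>"
  proof (cases "x $ 1 = 0 \<and> x $ 2 = 0")
    case True
    then show ?thesis using that[of 0 0] by simp
  next
    case False
    define \<rho> where "\<rho> = sqrt ((x $ 1)\<^sup>2 + (x $ 2)\<^sup>2)"
    have pos: "(x $ 1)\<^sup>2 + (x $ 2)\<^sup>2 > 0" using False by (simp add: sum_power2_gt_zero_iff)
    then have r: "\<rho> > 0" "\<rho>\<^sup>2 = (x $ 1)\<^sup>2 + (x $ 2)\<^sup>2" by (auto simp: \<rho>_def)
    have "(x $ 1 / \<rho>)\<^sup>2 + (x $ 2 / \<rho>)\<^sup>2 = ((x $ 1)\<^sup>2 + (x $ 2)\<^sup>2) / \<rho>\<^sup>2"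
      by (simp add: power_divide add_divide_distrib)
    also have "\<dots> = 1"
      using pos unfolding r(2) by (metis divide_self less_irrefl)
    finally have "(x $ 1 / \<rho>)\<^sup>2 + (x $ 2 / \<rho>)\<^sup>2 = 1" .
    then obtain t where "0 \<le> t" "t < 2 * pi" "x $ 1 / \<rho> = cos t" "x $ 2 / \<rho> = sin t"
      using sincos_total_2pi by metis
    then show ?thesis using that[of \<rho> t] r(1) by (simp add: field_simps)
  qed
  define i where "i = nat \<lfloor>\<phi> / \<delta>\<rfloor>"
  define \<psi> where "\<psi> = \<phi> - i * \<delta>"
  have fl: "real i \<le> \<phi> / \<delta>" "\<phi> / \<delta> < real i + 1"
    using p(2) delta(1) unfolding i_def by (auto simp: of_nat_nat)
  then have ps: "0 \<le> \<psi>" "\<psi> < \<delta>"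
    using delta(1) by (auto simp: \<psi>_def field_simps)
  have "i * \<delta> \<le> \<phi>" using ps by (simp add: \<psi>_def)
  also have "\<phi> < n * \<delta>" using p(3) delta(3) by simp
  finally have i: "i < n" using delta(1) by simp
  \<comment> \<open>Coordinates with respect to two vectors of length r at angle \<delta>, by the
    law of sines; both sines are nonnegative because \<psi> lies between 0 and \<delta>.\<close>
  define \<alpha> \<beta> where "\<alpha> = \<rho> * sin (\<delta> - \<psi>) / (r * sin \<delta>)" and "\<beta> = \<rho> * sin \<psi> / (r * sin \<delta>)"
  have pos: "\<alpha> \<ge> 0" "\<beta> \<ge> 0"
    using p(1) ps delta r by (auto simp: \<alpha>_def \<beta>_def intro!: divide_nonneg_pos mult_nonneg_nonneg sin_ge_zero)
  have phi: "\<phi> = i * \<delta> + \<psi>" and Si: "real (Suc i) * \<delta> = i * \<delta> + \<delta>" by (auto simp: \<psi>_def algebra_simps)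
  have ar: "\<alpha> * (r * u) + \<beta> * (r * v) = \<rho> * (sin (\<delta> - \<psi>) * u + sin \<psi> * v) / sin \<delta>" for u v
    using r by (simp add: \<alpha>_def \<beta>_def distrib_left add_divide_distrib)
  have "sin (\<delta> - \<psi>) * cos (i * \<delta>) + sin \<psi> * cos (real (Suc i) * \<delta>) = cos \<phi> * sin \<delta>"
    unfolding phi Si cos_add sin_diff by (simp add: algebra_simps)
  moreover have "sin (\<delta> - \<psi>) * sin (i * \<delta>) + sin \<psi> * sin (real (Suc i) * \<delta>) = sin \<phi> * sin \<delta>"
    unfolding phi Si sin_add sin_diff by (simp add: algebra_simps)
  ultimately have "\<rho> * cos \<phi> = \<alpha> * (r * cos (i * \<delta>)) + \<beta> * (r * cos (real (Suc i) * \<delta>))"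
    "\<rho> * sin \<phi> = \<alpha> * (r * sin (i * \<delta>)) + \<beta> * (r * sin (real (Suc i) * \<delta>))"
    unfolding ar using delta(5) by simp_all
  then show ?thesis using that[OF i pos] p by (simp add: vtx_def)
qed

lemma realization:
  "bipyramid_realization n (sqrt (r\<^sup>2 + h\<^sup>2)) (\<lambda>i. 2 * r * sin (\<delta> / 2)) (pole 1) (pole (-1)) vtx"
proof -
  define V where "V = insert (pole 1) (insert (pole (-1)) (vtx ` {..<n}))"
  define I where "I = {..<n} \<times> {1, -1::real}"
  have le: "nrml (i, e) \<bullet> vtx j \<le> 1" if "i < n" "j < n" for i j e
    using nrml_vtx_less[of i j e] nrml_vtx_eq[of i e] vtx_mod[of i] that by (cases "j = i \<or> j = Suc i mod n") auto
  have T: "{v \<in> V. nrml (i, e) \<bullet> v = 1} = {pole e, vtx i, vtx (Suc i mod n)}"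
    if "i < n" "e = 1 \<or> e = -1" for i e
  proof -
    have "vtx j \<in> {vtx i, vtx (Suc i mod n)}" if "j < n" "nrml (i, e) \<bullet> vtx j = 1" for j
      using nrml_vtx_less[of i j e] that \<open>i < n\<close> by (cases "j = i \<or> j = Suc i mod n") auto
    moreover have "Suc i mod n < n" using n by simp
    moreover have "nrml (i, e) \<bullet> vtx (Suc i mod n) = 1" using nrml_vtx_eq[of i e] vtx_mod[of i] that by simp
    ultimately show ?thesis
      using that nrml_vtx_eq[of i e] by (auto simp: V_def nrml_pole)
  qed
  have finV: "finite V" by (simp add: V_def)
  have leV: "nrml ie \<bullet> v \<le> 1" if "ie \<in> I" "v \<in> V" for ie v
    using that le by (auto simp: I_def V_def nrml_pole)
  have adj: "vtx i \<noteq> vtx (Suc i mod n)" if "i < n" for i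
  proof -
    have "i \<noteq> Suc i mod n" using n that by (cases "Suc i = n") auto
    then show ?thesis using inj_onD[OF inj_vtx, of i "Suc i mod n"] n that by auto
  qed
  have dimT: "aff_dim {v \<in> V. nrml ie \<bullet> v = 1} = int DIM(real^3) - 1" if m: "ie \<in> I" for ie
  proof -
    obtain i e where ie: "ie = (i, e)" "i < n" "e = 1 \<or> e = -1" using m by (cases ie) (auto simp: I_def)
    let ?t = "{vtx i, pole e, vtx (Suc i mod n)}"
    have "\<not> collinear ?t"
    proof
      assume "collinear ?t"
      then obtain u where "pole e = u *\<^sub>R vtx i + (1 - u) *\<^sub>R vtx (Suc i mod n)"
        using adj[OF ie(2)] unfolding collinear_3_expand by blast
      then have "pole e $ 3 = (u *\<^sub>R vtx i + (1 - u) *\<^sub>R vtx (Suc i mod n)) $ 3" by simp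
      then show False using h ie by (auto simp: pole_def vtx_def)
    qed
    then have "aff_dim ?t > 1" by (simp add: collinear_aff_dim)
    moreover have "aff_dim ?t \<le> int (card ?t) - 1" by (rule aff_dim_le_card) simp
    moreover have "card ?t \<le> 3" using card_insert_le_m1 by (simp add: card_insert_if)
    ultimately have "aff_dim ?t = 2" by linarith
    moreover have "?t = {pole e, vtx i, vtx (Suc i mod n)}" by auto
    ultimately show ?thesis using T[OF ie(2,3)] ie(1) by simp
  qed
  have cover: "x \<in> convex hull V" if x: "\<And>ie. ie \<in> I \<Longrightarrow> nrml ie \<bullet> x < 1" for x
  proof -
    obtain i \<alpha> \<beta> where s: "i < n" "\<alpha> \<ge> 0" "\<beta> \<ge> 0"
      "x $ 1 = (\<alpha> *\<^sub>R vtx i + \<beta> *\<^sub>R vtx (Suc i)) $ 1" "x $ 2 = (\<alpha> *\<^sub>R vtx i + \<beta> *\<^sub>R vtx (Suc i)) $ 2"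
      using sector by blast
    \<comment> \<open>Sector and sign of the height single out a cone over one facet that contains
      x. The functional of that facet is 1 at its three corners, so its value at x is the sum of the
      weights; 0, the midpoint of the poles, takes the remaining weight.\<close>
    define e where "e = (if x $ 3 \<ge> 0 then 1 else -1 :: real)"
    define \<gamma> where "\<gamma> = \<bar>x $ 3\<bar> / h"
    have e: "e = 1 \<or> e = -1" by (auto simp: e_def)
    have g: "\<gamma> \<ge> 0" "\<gamma> * (e * h) = x $ 3" using h by (auto simp: \<gamma>_def e_def)
    have eq: "x = \<alpha> *\<^sub>R vtx i + \<beta> *\<^sub>R vtx (Suc i) + \<gamma> *\<^sub>R pole e"
      using s g by (auto simp: vec_eq_iff forall_3 pole_def vtx_def)
    have "nrml (i, e) \<bullet> x < 1" using x s(1) e by (auto simp: I_def)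
    then have lt: "\<alpha> + \<beta> + \<gamma> \<le> 1"
      using e unfolding eq by (auto simp: inner_add_right nrml_vtx_eq nrml_pole)
    have "0 = (1/2) *\<^sub>R pole 1 + (1/2) *\<^sub>R pole (-1)" 
      by (simp add: vec_eq_iff forall_3 pole_def)
    moreover have "(1/2) *\<^sub>R pole 1 + (1/2) *\<^sub>R pole (-1) \<in> convex hull V"
      by (rule convexD[OF convex_convex_hull]) (auto simp: V_def intro: hull_inc)
    ultimately have z: "0 \<in> convex hull V" by simp
    have "vtx (Suc i) \<in> V" using vtx_mod[OF s(1)] n unfolding V_def
      by (metis imageI insertCI lessThan_iff mod_less_divisor not_less_eq_eq le0 order_less_le_trans zero_less_numeral gr_zeroI not_numeral_le_zero)
    then show ?thesis unfolding eq
      using s g e z lt by (intro convex_comb3_zero) (auto simp: V_def intro!: hull_inc)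
  qed
  note facets = facets_of_convex_hull[of V I nrml, OF finV _ leV dimT cover]
  have finI: "finite I" by (simp add: I_def)
  have F1: "aff_dim (convex hull V) = 3" using facets(1)[OF finI] by simp
  have "{F. F facet_of convex hull V} = (\<lambda>ie. convex hull {v \<in> V. nrml ie \<bullet> v = 1}) ` I"
    using facets(2)[OF finI] by simp
  also have "\<dots> = (\<lambda>i. convex hull {v \<in> V. nrml (i, 1) \<bullet> v = 1}) ` {..<n} \<union> (\<lambda>i. convex hull {v \<in> V. nrml (i, -1) \<bullet> v = 1}) ` {..<n}"
    by (auto simp: I_def)
  also have "\<dots> = (\<lambda>i. convex hull {pole 1, vtx i, vtx (Suc i mod n)}) ` {..<n} \<union>
      (\<lambda>i. convex hull {pole (-1), vtx i, vtx (Suc i mod n)}) ` {..<n}"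
    using T by auto
  finally have F2: "{F. F facet_of convex hull V} = (\<lambda>i. convex hull {pole 1, vtx i, vtx (Suc i mod n)}) ` {..<n} \<union>
      (\<lambda>i. convex hull {pole (-1), vtx i, vtx (Suc i mod n)}) ` {..<n}" .
  have pv: "pole e \<noteq> vtx i" if "e \<noteq> 0" for e i
    using h that by (auto simp: vec_eq_iff forall_3 pole_def vtx_def)
  have pp: "pole 1 \<noteq> pole (-1)"
    using h by (auto simp: vec_eq_iff forall_3 pole_def)
  have dp: "dist (pole e) (vtx i) = sqrt (r\<^sup>2 + h\<^sup>2)" if "e = 1 \<or> e = -1" for e i
  proof -
    have "(r * cos (i * \<delta>))\<^sup>2 + (r * sin (i * \<delta>))\<^sup>2 = r\<^sup>2"
      by (simp add: power_mult_distrib flip: distrib_left)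
    then show ?thesis
      using that by (auto simp: dist_vec_def L2_set_def sum_3 pole_def vtx_def dist_real_def)
  qed
  have dv: "dist (vtx i) (vtx (Suc i mod n)) = 2 * r * sin (\<delta> / 2)" if "i < n" for i
  proof -
    have chord: "(r * a - r * b)\<^sup>2 + (r * c - r * d)\<^sup>2 =
        r\<^sup>2 * (a\<^sup>2 + c\<^sup>2) + r\<^sup>2 * (b\<^sup>2 + d\<^sup>2) - 2 * r\<^sup>2 * (b * a + d * c)" for a b c d
      by (simp add: power2_eq_square algebra_simps)
    have "(dist (vtx i) (vtx (Suc i)))\<^sup>2 =
        (r * cos (i * \<delta>) - r * cos (Suc i * \<delta>))\<^sup>2 + (r * sin (i * \<delta>) - r * sin (Suc i * \<delta>))\<^sup>2"
      by (simp add: dist_vec_def L2_set_def sum_3 vtx_def dist_real_def)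
    also have "\<dots> = r\<^sup>2 * ((cos (i * \<delta>))\<^sup>2 + (sin (i * \<delta>))\<^sup>2) + r\<^sup>2 * ((cos (Suc i * \<delta>))\<^sup>2 + (sin (Suc i * \<delta>))\<^sup>2)
        - 2 * r\<^sup>2 * (cos (Suc i * \<delta>) * cos (i * \<delta>) + sin (Suc i * \<delta>) * sin (i * \<delta>))"
      by (rule chord)
    also have "\<dots> = r\<^sup>2 * (2 - 2 * cos (Suc i * \<delta> - i * \<delta>))"
      unfolding cos_diff by (simp add: algebra_simps)
    also have "Suc i * \<delta> - i * \<delta> = 2 * (\<delta> / 2)" by (simp add: algebra_simps)
    also have "r\<^sup>2 * (2 - 2 * cos (2 * (\<delta> / 2))) = (2 * r * sin (\<delta> / 2))\<^sup>2"
      unfolding cos_double_sin by (simp add: power2_eq_square algebra_simps)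
    finally have "dist (vtx i) (vtx (Suc i)) = \<bar>2 * r * sin (\<delta> / 2)\<bar>"
      using real_sqrt_abs abs_of_nonneg[OF zero_le_dist] by metis
    moreover have "sin (\<delta> / 2) \<ge> 0" using delta by (intro sin_ge_zero) auto
    ultimately show ?thesis using r vtx_mod[OF that] by simp
  qed
  show ?thesis
    unfolding bipyramid_realization_def Let_def
    using F1 F2 pv[of 1] pv[of "-1"] pp dp dv inj_vtx n unfolding V_def by auto
qed

end

lemma ex_int_bipyramid_regular:
  assumes "n \<ge> 3"
  shows "\<exists>s. int_bipyramid n s (\<lambda>_. 1)"
proof -
  define r where "r = 1 / (2 * sin (pi / n))"
  have "0 < sin (pi / n)" using assms by (intro sin_gt_zero) (auto simp: field_simps)
  then have rad: "r > 0" "2 * r * sin (pi / n) = 1" by (simp_all add: r_def)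
  \<comment> \<open>r is the circumradius for unit sides. The summand 1 keeps s strictly above r
    even when r is an integer, as for the hexagon, so that the height is positive.\<close>
  define s where "s = \<lceil>r\<rceil> + 1"
  have s: "real_of_int s > r" unfolding s_def by linarith
  define h where "h = sqrt ((real_of_int s)\<^sup>2 - r\<^sup>2)"
  have pos: "(real_of_int s)\<^sup>2 - r\<^sup>2 > 0" using s rad by (simp add: power_strict_mono)
  interpret regular_bipyramid n r h
    using assms rad pos by unfold_locales (auto simp: h_def)
  have "sqrt (r\<^sup>2 + h\<^sup>2) = real_of_int s" using pos s rad by (simp add: h_def)
  moreover have "2 * r * sin (\<delta> / 2) = 1" using rad by (simp add: \<delta>_def)
  ultimately have "bipyramid_realization n (of_int s) (\<lambda>i. of_int 1) (pole 1) (pole (-1)) vtx"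
    using realization by simp
  then show ?thesis unfolding int_bipyramid_def by blast
qed

section \<open>Equilateral chains on a circle\<close>

text \<open>Four nonzero pairwise orthogonal vectors would be independent in dimension 3.\<close>

lemma orthogonal_to_three_imp_zero:
  fixes e f g m :: "real^3"
  assumes "e \<noteq> 0" "f \<noteq> 0" "g \<noteq> 0" "e \<bullet> f = 0" "e \<bullet> g = 0" "f \<bullet> g = 0"
    and "m \<bullet> e = 0" "m \<bullet> f = 0" "m \<bullet> g = 0"
  shows "m = 0"
proof (rule ccontr)
  assume m: "m \<noteq> 0"
  have ne: "x \<noteq> y" if "x \<bullet> y = 0" "x \<noteq> 0" for x y :: "real^3" using that by auto
  have "pairwise orthogonal {e, f, g, m}"
    using assms by (auto simp: pairwise_def orthogonal_def inner_commute)
  then have "independent {e, f, g, m}"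
    by (rule pairwise_orthogonal_independent) (use assms m in auto)
  then have "card {e, f, g, m} \<le> 3" using independent_bound[of "{e, f, g, m}"] by simp
  moreover have "card {e, f, g, m} = 4"
    using ne[of e f] ne[of e g] ne[of f g] ne[of m e] ne[of m f] ne[of m g] assms m by auto
  ultimately show False by simp
qed

text \<open>The points lie on a circle in the bisecting plane of \<open>N\<close> and \<open>S\<close>. The two neighbours of a point are
  distinct, hence are the two points at the given chord distance, so the chain rotates by a constant
  angle. Convexity is not used: the chain may be a star polygon, but injectivity still makes the
  rotation have order exactly \<open>n\<close>.\<close>

lemma equilateral_chain_rotation:
  fixes p :: "nat \<Rightarrow> real^3" and N S :: "real^3" and n :: nat
  defines "M \<equiv> (1/2) *\<^sub>R (N + S)"
  defines "c \<equiv> ((p 0 - M) \<bullet> (p 1 - M)) / ((p 0 - M) \<bullet> (p 0 - M))"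
  assumes n: "n \<ge> 3" and NS: "N \<noteq> S" and inj: "inj_on p {..<n}"
    and dist: "\<And>i. i < n \<Longrightarrow> dist (p i) (p (Suc i mod n)) = l \<and> dist N (p i) = s \<and> dist S (p i) = s"
  obtains \<zeta> :: complex where "\<zeta>\<^sup>2 - 2 * of_real c * \<zeta> + 1 = 0" "\<zeta> ^ n = 1"
    "\<And>k. 0 < k \<Longrightarrow> k < n \<Longrightarrow> \<zeta> ^ k \<noteq> 1"
proof -
  \<comment> \<open>Periodic in i, so the recurrence below runs over all indices without wrap-around
    cases.\<close>
  define w where "w i = p (i mod n) - M" for i
  define e where "e = N - S"
  have e: "e \<noteq> 0" using NS by (simp add: e_def)
  have mn: "i mod n < n" for i using n by simp
  have N: "N = M + (1/2) *\<^sub>R e" and S: "S = M - (1/2) *\<^sub>R e"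
    by (simp_all add: M_def e_def vec_eq_iff field_simps)
  have dN: "((1/2) *\<^sub>R e - w i) \<bullet> ((1/2) *\<^sub>R e - w i) = s\<^sup>2"
    and dS: "((1/2) *\<^sub>R e + w i) \<bullet> ((1/2) *\<^sub>R e + w i) = s\<^sup>2" for i
  proof -
    have "dist N (p (i mod n)) = norm ((1/2) *\<^sub>R e - w i)"
      unfolding dist_norm w_def N by (simp add: algebra_simps)
    then show "((1/2) *\<^sub>R e - w i) \<bullet> ((1/2) *\<^sub>R e - w i) = s\<^sup>2"
      using dist[OF mn, of i] by (simp add: dot_square_norm)
    have "dist S (p (i mod n)) = norm (- ((1/2) *\<^sub>R e + w i))"
      unfolding dist_norm w_def S by (simp add: algebra_simps)
    also have "\<dots> = norm ((1/2) *\<^sub>R e + w i)" by (rule norm_minus_cancel)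
    finally have "dist S (p (i mod n)) = norm ((1/2) *\<^sub>R e + w i)" .
    then show "((1/2) *\<^sub>R e + w i) \<bullet> ((1/2) *\<^sub>R e + w i) = s\<^sup>2"
      using dist[OF mn, of i] by (simp add: dot_square_norm)
  qed
  define R where "R = s\<^sup>2 - (e \<bullet> e) / 4"
  have dN': "(e \<bullet> e) / 4 - w i \<bullet> e + w i \<bullet> w i = s\<^sup>2"
    and dS': "(e \<bullet> e) / 4 + w i \<bullet> e + w i \<bullet> w i = s\<^sup>2" for i
    using dN[of i] dS[of i] by (simp_all add: inner_diff inner_add inner_commute[of e "w i"] field_simps)
  have we: "w i \<bullet> e = 0" for i
    using dN'[of i] dS'[of i] by linarith
  then have ww: "w i \<bullet> w i = R" for i
    using dN'[of i] unfolding R_def by simp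
  have w_eqD: "i mod n = j mod n" if "w i = w j" for i j
    using that inj_onD[OF inj, of "i mod n" "j mod n"] mn by (simp add: w_def)
  have "R \<noteq> 0"
  proof
    assume "R = 0"
    then have "w 0 = w 1" using ww[of 0] ww[of 1] by simp
    then show False using w_eqD[of 0 1] n by simp
  qed
  then have R: "R > 0" using ww[of 0] inner_ge_zero[of "w 0"] by linarith
  have c: "c = (w 0 \<bullet> w 1) / R" using n ww[of 0] by (simp add: c_def w_def)
  define D where "D = R - l\<^sup>2 / 2"
  have adj: "w i \<bullet> w (Suc i) = D" for i
  proof -
    have "dist (p (i mod n)) (p (Suc i mod n)) = norm (w i - w (Suc i))"
      unfolding dist_norm w_def by simp
    then have "(w i - w (Suc i)) \<bullet> (w i - w (Suc i)) = l\<^sup>2"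
      using dist[OF mn, of i] by (simp add: dot_square_norm mod_Suc_eq)
    then show ?thesis
      using ww[of i] ww[of "Suc i"] by (simp add: D_def inner_diff inner_commute[of "w (Suc i)" "w i"])
  qed
  have D: "D = c * R" using adj[of 0] R by (simp add: c)
  have rec: "w (Suc (Suc i)) = (2 * c) *\<^sub>R w (Suc i) - w i" for i
  proof -
    \<comment> \<open>The pole axis, the middle point and the difference of its neighbours are
      nonzero and pairwise orthogonal; \<open>?m\<close> is orthogonal to all three. The difference
      is nonzero because n does not divide 2.\<close>
    let ?d = "w (Suc (Suc i)) - w i"
    let ?m = "w (Suc (Suc i)) + w i - (2 * c) *\<^sub>R w (Suc i)"
    have "?d \<noteq> 0"
    proof
      assume "?d = 0"
      then have "(i + 2) mod n = i mod n" using w_eqD[of "Suc (Suc i)" i] by simp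
      then have "n dvd 2" using mod_eq_dvd_iff_nat[of i "i + 2" n] by simp
      then show False using n by (auto dest: dvd_imp_le)
    qed
    moreover have "w (Suc i) \<noteq> 0" using ww[of "Suc i"] R by auto
    moreover have "?d \<bullet> w (Suc i) = 0"
      using adj[of i] adj[of "Suc i"] by (simp add: inner_diff_left inner_commute[of "w (Suc (Suc i))"])
    moreover have "?m \<bullet> w (Suc i) = 0"
      using adj[of i] adj[of "Suc i"] ww[of "Suc i"] D
      by (simp add: inner_diff_left inner_add_left inner_commute[of "w (Suc (Suc i))"])
    moreover have "?m \<bullet> ?d = 0"
      using adj[of i] adj[of "Suc i"] ww[of "Suc (Suc i)"] ww[of i]
      by (simp add: inner_diff inner_add inner_commute[of "w (Suc (Suc i))" "w i"] inner_commute[of "w (Suc i)" "w i"])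
    moreover have "?m \<bullet> e = 0" by (simp add: inner_diff inner_add we)
    moreover have "e \<bullet> w (Suc i) = 0" by (simp add: inner_commute[of e] we)
    moreover have "e \<bullet> ?d = 0" by (simp add: inner_diff_right inner_commute[of e] we)
    ultimately have "?m = 0"
      using e by (intro orthogonal_to_three_imp_zero[of e "w (Suc i)" ?d])
        (simp_all only: inner_commute[of "w (Suc i)" ?d] not_False_eq_True)
    then show ?thesis by (simp add: algebra_simps)
  qed
  have "\<bar>w 0 \<bullet> w 1\<bar> \<le> norm (w 0) * norm (w 1)" by (rule Cauchy_Schwarz_ineq2)
  also have "\<dots> = R" using ww[of 0] ww[of 1] R by (simp add: norm_eq_sqrt_inner)
  finally have "\<bar>c\<bar> \<le> 1" using R by (simp add: c abs_divide)
  then obtain \<theta> where th: "c = cos \<theta>" by (metis abs_le_iff cos_arccos minus_le_iff)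
  \<comment> \<open>The recurrence for w is that of cosines of multiples of \<theta>, so inner
    products with \<open>w 0\<close> suffice and no coordinates in the equator plane are
    chosen.\<close>
  have wk: "w 0 \<bullet> w k = R * cos (k * \<theta>)" for k
  proof (induction k rule: induct_nat_012)
    case 0 show ?case by (simp add: ww)
  next
    case 1 show ?case using adj[of 0] D th by simp
  next
    case (ge2 k)
    have "w 0 \<bullet> w (Suc (Suc k)) = 2 * c * (w 0 \<bullet> w (Suc k)) - w 0 \<bullet> w k"
      unfolding rec[of k] by (simp add: inner_diff_right)
    also have "\<dots> = R * (2 * cos (Suc k * \<theta>) * cos \<theta> - cos (k * \<theta>))"
      unfolding ge2.IH th by (simp add: algebra_simps)
    also have "2 * cos (Suc k * \<theta>) * cos \<theta> = cos (Suc k * \<theta> - \<theta>) + cos (Suc k * \<theta> + \<theta>)"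
      by (simp add: cos_add cos_diff)
    also have "Suc k * \<theta> - \<theta> = k * \<theta>" by (simp add: algebra_simps)
    also have "Suc k * \<theta> + \<theta> = Suc (Suc k) * \<theta>" by (simp add: algebra_simps)
    finally show ?case by simp
  qed
  have "w n = w 0" by (simp add: w_def)
  then have cn: "cos (n * \<theta>) = 1" using wk[of n] ww[of 0] R by simp
  \<comment> \<open>Cosine 1 would give \<open>w k\<close> the same inner product with
    \<open>w 0\<close> as \<open>w 0\<close> itself; as the lengths agree, the two points would
    coincide.\<close>
  have ck: "cos (k * \<theta>) \<noteq> 1" if "0 < k" "k < n" for k
  proof
    assume "cos (k * \<theta>) = 1"
    then have "(w 0 - w k) \<bullet> (w 0 - w k) = 0"
      using wk[of k] ww[of 0] ww[of k] by (simp add: inner_diff inner_commute[of "w k" "w 0"])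
    then show False using w_eqD[of 0 k] that by simp
  qed
  have pow: "cis \<theta> ^ k = cis (k * \<theta>)" for k by (rule Complex.DeMoivre)
  show thesis
  proof (rule that[of "cis \<theta>"])
    have "cis \<theta> * cis \<theta> + 1 = 2 * of_real c * cis \<theta>"
      using sin_cos_squared_add[of \<theta>] unfolding th
      by (auto simp: complex_eq_iff power2_eq_square algebra_simps)
    then show "(cis \<theta>)\<^sup>2 - 2 * of_real c * cis \<theta> + 1 = 0" by (simp add: power2_eq_square algebra_simps)
    have "sin (n * \<theta>) = 0" using cn sin_cos_squared_add[of "n * \<theta>"] by simp
    then show "cis \<theta> ^ n = 1" unfolding pow using cn by (simp add: complex_eq_iff)
    show "cis \<theta> ^ k \<noteq> 1" if "0 < k" "k < n" for k
      unfolding pow using ck[OF that] by (auto simp: complex_eq_iff)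
  qed
qed

section \<open>Computation trees\<close>

lemma poly_map_poly_of_real: "poly (map_poly of_real p) (of_real x :: complex) = of_real (poly p x)"
  by (induction p) (simp_all add: map_poly_pCons)

lemma get_in_subfield:
  assumes "is_subfield L" "of_real ` set vs \<subseteq> L"
  shows "of_real (get vs i) \<in> (L :: complex set)"
  using assms is_subfieldD(2)[OF assms(1)] by (auto simp: get_def)

text \<open>On a fixed input one path is followed: comparisons choose it without creating values,
  each computing node enlarges the field once, and an out-of-range read gives 0, which every field
  contains.\<close>

lemma run_outputs_in_extension:
  fixes good :: "complex set \<Rightarrow> bool"
  assumes good: "\<And>L. good L \<Longrightarrow> is_subfield L"
    and step: "\<And>L f vs. good L \<Longrightarrow> of_real ` set vs \<subseteq> L \<Longrightarrow> f \<in> Ops \<Longrightarrow>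
      \<exists>L'. good L' \<and> L \<subseteq> L' \<and> of_real (eval_op f vs) \<in> L'"
    and t: "ops_of t \<subseteq> Ops" and L: "good L" "of_real ` set vs \<subseteq> L"
  shows "\<exists>L'. good L' \<and> of_real ` set (run t vs) \<subseteq> L'"
  using t L
proof (induction t arbitrary: L vs)
  case (Leaf outs)
  have "of_real (get vs i) \<in> L" for i by (rule get_in_subfield[OF good[OF Leaf(2)] Leaf(3)])
  then show ?case using Leaf(2) by auto
next
  case (Step f t)
  obtain L' where L': "good L'" "L \<subseteq> L'" "of_real (eval_op f vs) \<in> L'"
    using step[OF Step.prems(2,3), of f] Step.prems(1) by auto
  show ?case
    using Step.IH[of L' "vs @ [eval_op f vs]"] Step.prems(1,3) L' by auto
next
  case (Branch i j t1 t2)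
  then show ?case by auto
qed

lemma eval_op_arith_in_subfield:
  fixes L :: "complex set"
  assumes L: "is_subfield L" "of_real ` set vs \<subseteq> L"
    and f: "\<And>k i. f \<noteq> KRoot k i" "\<And>cs j. f \<noteq> PolyRoot cs j"
  shows "of_real (eval_op f vs) \<in> L"
proof -
  have g: "of_real (get vs i) \<in> L" for i by (rule get_in_subfield[OF L])
  have q: "of_real (real_of_rat c) \<in> L" for c
    using Rats_subset_subfield[OF L(1)] by auto
  show ?thesis
    by (cases f) (use f g q in \<open>auto intro!: is_subfieldD(3,4,6,8)[OF L(1)]\<close>)
qed

lemma rat_degree_coprime_eval_op:
  assumes q: "prime q" "d < q" and L: "rat_degree_coprime q L" "of_real ` set vs \<subseteq> L"
    and f: "\<And>k i. f \<noteq> KRoot k i" "\<And>cs j. f = PolyRoot cs j \<Longrightarrow> length cs \<le> d + 1"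
  shows "\<exists>L'. rat_degree_coprime q L' \<and> L \<subseteq> L' \<and> of_real (eval_op f vs) \<in> L'"
proof -
  have L': "is_subfield L" using L(1) by (simp add: rat_degree_coprime_def)
  consider "\<And>cs j. f \<noteq> PolyRoot cs j" | cs j where "f = PolyRoot cs j" by blast
  then show ?thesis
  proof cases
    case 1
    then show ?thesis using eval_op_arith_in_subfield[OF L' L(2) f(1)] L(1) by blast
  next
    case (2 cs j)
    let ?p = "Poly (map (get vs) cs)" and ?x = "eval_op f vs"
    show ?thesis
    \<comment> \<open>When the requested root is missing, or the polynomial is zero, the node
      returns the default 0 and the field stays as it is.\<close>
    proof (cases "j < length (real_roots_sorted ?p)")
      case False
      then have "?x = 0" by (simp add: 2 Let_def)
      then show ?thesis using is_subfieldD(2)[OF L'] L(1) by auto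
    next
      case True
      then have p0: "?p \<noteq> 0" by (auto simp: real_roots_sorted_def)
      have "?x \<in> set (real_roots_sorted ?p)" using True by (simp add: 2 Let_def)
      then have root: "poly ?p ?x = 0"
        using p0 poly_roots_finite[OF p0] by (simp add: real_roots_sorted_def)
      let ?P = "map_poly of_real ?p :: complex poly"
      have "poly_over L ?P"
        using get_in_subfield[OF L' L(2)] is_subfieldD(2)[OF L']
        by (auto simp: poly_over_def coeff_map_poly nth_default_def)
      moreover have "?P \<noteq> 0" using p0 by (simp add: map_poly_eq_0_iff)
      moreover have "poly ?P (of_real ?x) = of_real (poly ?p ?x)"
        by (rule poly_map_poly_of_real)
      moreover have "degree ?p < q"
      proof -
        have "length cs \<noteq> 0" using p0 by auto
        moreover have "degree ?p = length (coeffs ?p) - 1" by (rule degree_eq_length_coeffs)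
        moreover have "length (coeffs ?p) \<le> length cs"
          using length_strip_while_le[of "(=) 0" "map (get vs) cs"] by simp
        ultimately show ?thesis using f(2)[OF 2] q(2) by linarith
      qed
      moreover have "degree ?P = degree ?p" by (rule degree_map_poly) simp
      ultimately have "rat_degree_coprime q (adjoin L (of_real ?x))"
        using root by (intro rat_degree_coprime_adjoin[OF q(1) L(1), of ?P]) auto
      then show ?thesis using subset_adjoin[OF L'] by blast
    qed
  qed
qed

lemma no_trisection_root_eval_op:
  assumes L: "no_trisection_root L" "of_real ` set vs \<subseteq> L" and f: "\<And>cs j. f \<noteq> PolyRoot cs j"
  shows "\<exists>L'. no_trisection_root L' \<and> L \<subseteq> L' \<and> of_real (eval_op f vs) \<in> L'"
proof -
  have L': "is_subfield L" using L(1) by (simp add: no_trisection_root_def)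
  consider "\<And>k i. f \<noteq> KRoot k i" | k i where "f = KRoot k i" by blast
  then show ?thesis
  proof cases
    case 1
    then show ?thesis using eval_op_arith_in_subfield[OF L' L(2) _ f] L(1) by blast
  next
    case (2 k i)
    let ?v = "get vs i"
    have v: "of_real ?v \<in> L" by (rule get_in_subfield[OF L' L(2)])
    show ?thesis
    proof (cases "k = 0 \<or> ?v = 0")
      case True
      then have "eval_op f vs = 0" by (auto simp: 2)
      then show ?thesis using is_subfieldD(2)[OF L'] L(1) by auto
    next
      case False
      \<comment> \<open>\<open>root k\<close> is an odd function for every k, also for even k, so
        the value of the node is \<alpha> or - \<alpha> with \<alpha> positive.\<close>
      define \<alpha> where "\<alpha> = root k \<bar>?v\<bar>"
      have a: "\<alpha> > 0" "\<alpha> ^ k = \<bar>?v\<bar>" using False by (simp_all add: \<alpha>_def real_root_gt_zero)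
      have "of_real \<bar>?v\<bar> \<in> L" using v is_subfieldD(5)[OF L' v] by (cases "?v \<ge> 0") auto
      then have N: "no_trisection_root (adjoin L (of_real \<alpha>))"
        using a False by (intro no_trisection_root_adjoin_radical[OF L(1), of _ k]) auto
      then have A: "is_subfield (adjoin L (of_real \<alpha>))" by (simp add: no_trisection_root_def)
      have "eval_op f vs = \<alpha> \<or> eval_op f vs = - \<alpha>"
        by (simp add: 2 \<alpha>_def abs_if real_root_minus)
      then have "of_real (eval_op f vs) \<in> adjoin L (of_real \<alpha>)"
        using subset_adjoin(2)[OF L', of "of_real \<alpha>"] is_subfieldD(5)[OF A] by auto
      then show ?thesis using N subset_adjoin(1)[OF L'] by blast
    qed
  qed
qed

section \<open>From a computation on the regular bipyramid to a root of unity\<close>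

lemma inner_in_subfield:
  fixes x y :: "real^3"
  assumes L: "is_subfield (L :: complex set)" and "\<And>i. of_real (x $ i) \<in> L" "\<And>i. of_real (y $ i) \<in> L"
  shows "of_real (x \<bullet> y) \<in> L"
  using assms(2,3) by (auto simp: inner_vec_def sum_3 intro!: is_subfieldD(4,6)[OF L])

text \<open>The reduction shared by both models, with the field invariant as a parameter. The inputs
  are integers, so the tower starts at the rationals; c is a rational expression in the output
  coordinates, whichever realization is returned.\<close>

lemma computes_imp_root_of_unity:
  fixes good :: "complex set \<Rightarrow> bool"
  assumes good: "\<And>L. good L \<Longrightarrow> is_subfield L" "good \<rat>"
    and step: "\<And>L f vs. good L \<Longrightarrow> of_real ` set vs \<subseteq> L \<Longrightarrow> f \<in> ops_of (T n) \<Longrightarrow>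
      \<exists>L'. good L' \<and> L \<subseteq> L' \<and> of_real (eval_op f vs) \<in> L'"
    and T: "computes_bipyramids T" and n: "n \<ge> 3"
  obtains L c \<zeta> where "good L" "c \<in> L" "\<zeta>\<^sup>2 - 2 * c * \<zeta> + 1 = 0" "\<zeta> ^ n = 1"
    "\<And>k. 0 < k \<Longrightarrow> k < n \<Longrightarrow> \<zeta> ^ k \<noteq> 1"
proof -
  obtain s where s: "int_bipyramid n s (\<lambda>_. 1)" using ex_int_bipyramid_regular[OF n] by blast
  define vs where "vs = map real_of_int (s # map (\<lambda>_. 1) [0..<n])"
  define out where "out = run (T n) vs"
  let ?N = "out_point out n" and ?S = "out_point out (n + 1)" and ?p = "out_point out"
  have out: "length out = 3 * (n + 2)"
    and real: "bipyramid_realization n (of_int s) (\<lambda>i. of_int 1) ?N ?S ?p"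
    using T s unfolding computes_bipyramids_def out_def vs_def Let_def by blast+
  have "of_real ` set vs \<subseteq> \<rat>" by (auto simp: vs_def)
  then obtain L where L: "good L" "of_real ` set out \<subseteq> L"
    using run_outputs_in_extension[of good "ops_of (T n)" "T n" "\<rat>" vs, OF good(1) step _ good(2)]
    unfolding out_def by auto
  note SL = good(1)[OF L(1)]
  have coord: "of_real (?p k $ i) \<in> L" if "k < n + 2" for k i
  proof -
    have "of_real (out ! m) \<in> L" if "m < 3 * (n + 2)" for m
      using L(2) nth_mem[of m out] out that by auto
    then show ?thesis using that exhaust_3[of i] by (auto simp: out_point_def)
  qed
  define M where "M = (1/2) *\<^sub>R (?N + ?S)"
  have "1/2 \<in> (\<rat> :: complex set)" by auto
  then have half: "1/2 \<in> L" using Rats_subset_subfield[OF SL] by blast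
  have M: "of_real (M $ i) \<in> L" for i
  proof -
    have "1/2 * (of_real (?N $ i) + of_real (?S $ i)) \<in> L"
      by (rule is_subfieldD(6)[OF SL half is_subfieldD(4)[OF SL coord coord]]) simp_all
    moreover have "M $ i = 1/2 * (?N $ i + ?S $ i)" by (simp add: M_def)
    then have "of_real (M $ i) = 1/2 * (of_real (?N $ i) + of_real (?S $ i) :: complex)"
      by (simp only: of_real_mult of_real_add of_real_divide of_real_1 of_real_numeral)
    ultimately show ?thesis by (simp only:)
  qed
  have diff: "of_real ((?p k - M) $ i) \<in> L" if "k < n" for k i
    using is_subfieldD(3)[OF SL coord[of k i] M[of i]] that by simp
  define c where "c = ((?p 0 - M) \<bullet> (?p 1 - M)) / ((?p 0 - M) \<bullet> (?p 0 - M))"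
  have c: "of_real c \<in> L"
    unfolding c_def of_real_divide
    by (intro is_subfieldD(8)[OF SL] inner_in_subfield[OF SL] diff) (use n in auto)
  have r: "?N \<noteq> ?S" "inj_on ?p {..<n}"
    "\<And>i. i < n \<Longrightarrow> dist (?p i) (?p (Suc i mod n)) = 1 \<and> dist ?N (?p i) = of_int s \<and> dist ?S (?p i) = of_int s"
    using real unfolding bipyramid_realization_def Let_def by auto
  obtain \<zeta> :: complex where "\<zeta>\<^sup>2 - 2 * of_real c * \<zeta> + 1 = 0" "\<zeta> ^ n = 1"
    "\<And>k. 0 < k \<Longrightarrow> k < n \<Longrightarrow> \<zeta> ^ k \<noteq> 1"
    by (rule equilateral_chain_rotation[OF n r]) (simp_all only: c_def M_def, blast)
  then show thesis using that[OF L(1) c] by blast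
qed

lemma no_radical_tree:
  assumes rad: "\<forall>n. radical_tree (T n)" and T: "computes_bipyramids T"
  shows False
proof -
  obtain L c \<zeta> where L: "no_trisection_root L" "c \<in> L" and z: "\<zeta>\<^sup>2 - 2 * c * \<zeta> + 1 = 0" "\<zeta> ^ 9 = 1" "\<zeta> ^ 3 \<noteq> 1"
  proof (rule computes_imp_root_of_unity[of no_trisection_root T 9])
    show "is_subfield L" if "no_trisection_root L" for L using that by (simp add: no_trisection_root_def)
    show "\<exists>L'. no_trisection_root L' \<and> L \<subseteq> L' \<and> of_real (eval_op f vs) \<in> L'"
      if "no_trisection_root L" "of_real ` set vs \<subseteq> L" "f \<in> ops_of (T 9)" for L f vs
      using that rad by (intro no_trisection_root_eval_op) (auto simp: radical_tree_def)
  qed (use T no_trisection_root_Rats in auto)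
  have "\<zeta> \<noteq> 0" using z(2) by auto
  have "(\<zeta> ^ 3 - 1) * ((\<zeta> ^ 3)\<^sup>2 + \<zeta> ^ 3 + 1) = \<zeta> ^ 9 - 1"
    by (simp add: algebra_simps power2_eq_square flip: power_add)
  then have w: "(\<zeta> ^ 3)\<^sup>2 + \<zeta> ^ 3 + 1 = 0" using z by simp
  have c: "2 * c * \<zeta> = \<zeta>\<^sup>2 + 1" using z(1) by (simp add: algebra_simps)
  \<comment> \<open>Here \<open>2 * c\<close> is \<zeta> plus its inverse; multiplying the cubic by
    \<open>\<zeta> ^ 3\<close> clears the inverses and leaves the cyclotomic polynomial of order
    9.\<close>
  have "\<zeta> ^ 3 * ((2 * c) ^ 3 - 3 * (2 * c) + 1) = (2 * c * \<zeta>) ^ 3 - 3 * (2 * c * \<zeta>) * \<zeta>\<^sup>2 + \<zeta> ^ 3"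
    by (simp add: power2_eq_square power3_eq_cube algebra_simps)
  also have "\<dots> = (\<zeta> ^ 3)\<^sup>2 + \<zeta> ^ 3 + 1"
    unfolding c by (simp add: power2_eq_square power3_eq_cube algebra_simps)
  finally have "(2 * c) ^ 3 - 3 * (2 * c) + 1 = 0" using w \<open>\<zeta> \<noteq> 0\<close> by simp
  then have "poly trisection_poly (2 * c) = 0" by (simp add: poly_trisection)
  moreover have SL: "is_subfield L" using L(1) by (simp add: no_trisection_root_def)
  then have "2 \<in> L" using Rats_subset_subfield[OF SL] by auto
  then have "2 * c \<in> L" by (rule is_subfieldD(6)[OF SL _ L(2)])
  ultimately show False using L(1) by (simp add: no_trisection_root_def)
qed

lemma no_root_tree:
  assumes root: "\<forall>n. root_tree d (T n)" and T: "computes_bipyramids T"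
  shows False
proof -
  \<comment> \<open>The degree bound d is fixed for the whole family of trees, so n may be chosen
    depending on it.\<close>
  obtain q where q: "prime q" "max d 2 < q" using bigger_prime by blast
  then have odd: "odd q" using prime_odd_nat[OF q(1)] by simp
  \<comment> \<open>Gives \<open>q < q\<^sup>2\<close>, so that q is among the exponents k at which
    \<zeta> is known not to be 1.\<close>
  have "2 * q < q * q" using q by simp
  then have "3 \<le> q * q" "q < q * q" using q(2) by linarith+
  then have n: "q\<^sup>2 \<ge> 3" "q < q\<^sup>2" by (simp_all add: power2_eq_square)
  obtain L c \<zeta> where L: "rat_degree_coprime q L" "c \<in> L"
    and z: "\<zeta>\<^sup>2 - 2 * c * \<zeta> + 1 = 0" "\<zeta> ^ q\<^sup>2 = 1" "\<zeta> ^ q \<noteq> 1"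
  proof (rule computes_imp_root_of_unity[of "rat_degree_coprime q" T "q\<^sup>2"])
    show "is_subfield L" if "rat_degree_coprime q L" for L using that by (simp add: rat_degree_coprime_def)
    show "\<exists>L'. rat_degree_coprime q L' \<and> L \<subseteq> L' \<and> of_real (eval_op f vs) \<in> L'"
      if "rat_degree_coprime q L" "of_real ` set vs \<subseteq> L" "f \<in> ops_of (T (q\<^sup>2))" for L f vs
      using that root q by (intro rat_degree_coprime_eval_op[of q d]) (auto simp: root_tree_def)
  qed (use T n q rat_degree_coprime_Rats in auto)
  show False
    by (rule rat_degree_coprime_no_root_of_unity[OF q(1) odd L(1) z(2,3) L(2) z(1)])
qed

theorem theorem13:
  shows "(\<not> (\<exists>T. (\<forall>n. radical_tree (T n)) \<and> computes_bipyramids T)) \<and>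
         (\<forall>d. \<not> (\<exists>T. (\<forall>n. root_tree d (T n)) \<and> computes_bipyramids T))"
  using no_radical_tree no_root_tree by blast

end
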